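(* For every $f$ analytic in $(-1,1)$ such that $$X(n)=\frac1n\sum_{d\mid n}\frac{f^{(d)}(0)}{\Gamma(d)}\,\mu\!\left(\frac nd\right)$$ is periodic-symmetric with period $T$ (Moebius periodic) and real-valued, one has $$e^{-f(q)}=\eta(T\tau)^{-\sum_{j=1}^{\left[\frac{T-1}{2}\right]}X(j)}\ \prod_{j=1}^{\left[\frac{T-1}{2}\right]}\vartheta\!\left(\frac T2,\frac{T-2j}{2};q\right)^{X(j)}$$ for every $|q|<1$. Moreover, assume the following (unproved) statement (C): for all positive rational numbers $a,p$ with $a<p$ and every positive rational $r$, with $q=e^{-\pi\sqrt r}$, the number $q^{\frac{p}{12}-\frac a2+\frac{a^2}{2p}}\prod_{n=0}^{\infty}(1-q^{pn+a})(1-q^{pn+p-a})$ is algebraic. In case the $X(j)$ are rational, $q^{A}e^{-f(q)}$ is algebraic when $q=e^{-\pi\sqrt r}$, $r$ positive rational, where $$A=\sum_{j=1}^{\left[\frac{T-1}{2}\right]}\left(-\frac j2+\frac{j^2}{2T}+\frac T{12}\right)X(j).$$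
   Context: For $|q|<1$, $\vartheta(a,b;q):=\sum_{n=-\infty}^{\infty}(-1)^nq^{an^2+bn}$. Here $\eta(\tau)=\prod_{n=1}^{\infty}(1-q^n)$ with $q=e^{i\pi\tau}$ (no factor $q^{1/24}$), so $\eta(T\tau)=\prod_{n=1}^\infty(1-q^{Tn})$. $\mu$ is the Moebius function, $\Gamma$ is the Gamma function ($\Gamma(d)=(d-1)!$), and $[x]$ in a summation or product limit is the integer part of $x$. A $T$-periodic sequence $X$, with $a_k=X(k+nT)=X(k)$ for every $n\in\mathbb N$, is called symmetric (catoptric) if $a_T=0$ and $a_1=a_{T-1},\ a_2=a_{T-2},\ \ldots,\ a_{(T-1)/2}=a_{(T+1)/2}$.
   Formalization: Added: f(0)=0 (X(n) does not depend on f(0); replacing f by f+1 breaks the formula), and, for even T, X(T/2)=0 (with T=2, X(1)=1, X(2)=0 the formula fails). For non-real q, f is assumed analytic in the whole unit disc. *)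

theory Defs
  imports
    "HOL-Complex_Analysis.Complex_Analysis"
    "HOL-Computational_Algebra.Computational_Algebra"
begin

definition mobius_mu :: "nat \<Rightarrow> int" where
  "mobius_mu n = (if squarefree n then (- 1) ^ card (prime_factors n) else 0)"

definition mobius_coeff :: "(complex \<Rightarrow> complex) \<Rightarrow> nat \<Rightarrow> complex" where
  "mobius_coeff f n =
     1 / of_nat n *
     (\<Sum>d | d dvd n. (deriv ^^ d) f 0 / Gamma (of_nat d) * of_int (mobius_mu (n div d)))"

text \<open>Sequences are indexed from 1; the value at 0 plays no role.\<close>

definition periodic_seq :: "nat \<Rightarrow> (nat \<Rightarrow> 'a) \<Rightarrow> bool" where
  "periodic_seq T a \<longleftrightarrow> (\<forall>k\<ge>1. \<forall>n. a (k + n * T) = a k)"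

definition catoptric :: "nat \<Rightarrow> (nat \<Rightarrow> 'a::zero) \<Rightarrow> bool" where
  "catoptric T a \<longleftrightarrow>
     periodic_seq T a \<and> a T = 0 \<and> (\<forall>j\<in>{1..(T - 1) div 2}. a j = a (T - j))"

text \<open>
  The power \<open>q\<^sup>x\<close> with the convention \<open>q\<^sup>0 = 1\<close> also for \<open>q = 0\<close> (the library has
  \<open>0 powr 0 = 0\<close>). For integral exponents, the only ones at which the theta functions
  of the main statement use it, the choice of the branch is immaterial.
\<close>

definition qpow :: "complex \<Rightarrow> real \<Rightarrow> complex" where
  "qpow q x = (if x = 0 then 1 else q powr complex_of_real x)"

definition theta :: "real \<Rightarrow> real \<Rightarrow> complex \<Rightarrow> complex" where
  "theta a b q =
     (\<Sum>\<^sub>\<infinity>n::int. (- 1) powi n * qpow q (a * (of_int n)\<^sup>2 + b * of_int n))"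

text \<open>
  The eta product (without the factor \<open>q\<^bsup>1/24\<^esup>\<close>) as a function of \<open>q = exp (\<i> \<pi> \<tau>)\<close>.
  Replacing \<open>\<tau>\<close> by \<open>T \<tau>\<close> amounts to replacing \<open>q\<close> by \<open>q ^ T\<close>.
\<close>

definition eta_q :: "complex \<Rightarrow> complex" where
  "eta_q q = (\<Prod>n. 1 - q ^ Suc n)"

text \<open>
  For a zero-free holomorphic \<open>g\<close> on the unit disc with \<open>g 0 = 1\<close>, the branch of the
  power \<open>g\<^sup>s\<close> that is holomorphic on the disc and equal to 1 at 0. The logarithm
  is unique on the disc; the principal branch \<open>g z powr s\<close> may be discontinuous there.
\<close>

definition disc_log :: "(complex \<Rightarrow> complex) \<Rightarrow> complex \<Rightarrow> complex" where
  "disc_log g =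
     (SOME h. h holomorphic_on ball 0 1 \<and> h 0 = 0 \<and> (\<forall>z\<in>ball 0 1. exp (h z) = g z))"

definition disc_powr :: "(complex \<Rightarrow> complex) \<Rightarrow> complex \<Rightarrow> complex \<Rightarrow> complex" where
  "disc_powr g s z = exp (s * disc_log g z)"

end

theory Submission
  imports Defs
begin

text \<open>
  Write \<open>a\<^sub>n = f\<^bsup>(n)\<^esup>(0) / n!\<close>. The definition of \<open>X\<close> says that \<open>n X(n)\<close> is the Dirichlet
  convolution of \<open>n a\<^sub>n\<close> with the Moebius function, so Moebius inversion
  (\<open>mobius_inversion\<close>) gives \<open>n a\<^sub>n = (\<Sum>d | d dvd n. d X(d))\<close>. Summing the Taylor series
  of \<open>f\<close> over pairs \<open>(d, m)\<close> with \<open>n = d m\<close> instead of over \<open>n\<close> turns it into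
  \<open>- (\<Sum>d. X(d) Ln (1 - z\<^sup>d))\<close>, which converges in the whole unit disc because a periodic
  sequence is bounded. Hence \<open>exp (- f(z))\<close> is the product of all \<open>(1 - z\<^sup>d)\<^bsup>X(d)\<^esup>\<close>, first near 0
  and then, by the identity theorem, on every connected domain in the disc that contains 0 and on
  which \<open>f\<close> is holomorphic (\<open>eq_neg_log_product_mobius_coeff\<close>).

  Periodicity and symmetry group this product by residue classes modulo \<open>T\<close>: the classes
  \<open>j\<close> and \<open>T - j\<close> share the exponent \<open>X(j)\<close>, while the classes of \<open>0\<close> and, for even \<open>T\<close>, of
  \<open>T / 2\<close> do not contribute (\<open>log_product_catoptric\<close>). By the Jacobi triple product
  (\<open>jacobi_triple_product\<close>), applied to \<open>q\<^sup>T\<close> and \<open>q\<^bsup>T - j\<^esup>\<close>, the product over the classes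
  \<open>j\<close>, \<open>T - j\<close> and \<open>0\<close> is the theta function of the theorem, and the class of \<open>0\<close> alone gives the
  eta product, so each pair of classes contributes a quotient theta / eta.

  All these identities are proved for logarithms that are holomorphic in the disc, vanish at 0 and
  are real on \<open>(-1, 1)\<close>. Both versions of the formula follow: on the real segment the principal
  powers are powers of positive numbers, and in the disc the logarithm of the definition of
  \<open>disc_powr\<close> is unique (\<open>disc_log_eq\<close>).

  For the algebraicity, the power of \<open>q\<close> splits in such a way that every pair of classes becomes one
  of the numbers of the assumption (C), raised to the rational power \<open>X(j)\<close>. What remains
  is that algebraic numbers are closed under products (\<open>algebraic_mult\<close>, by linear algebra over the
  rationals) and positive ones also under rational powers.
\<close>

section \<open>Moebius inversion\<close>

lemma prime_factors_prod_primes: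
  fixes S :: "nat set"
  assumes "finite S" "\<forall>p\<in>S. prime p"
  shows "prime_factors (\<Prod>S) = S"
proof -
  have "prime_factors (\<Prod>S) = (\<Union>p\<in>S. prime_factors p)"
    using assms by (subst prime_factors_prod) (auto simp: image_iff)
  also have "\<dots> = S"
    using assms by (auto simp: prime_prime_factors)
  finally show ?thesis .
qed

lemma squarefree_eq_prod_prime_factors:
  fixes d :: nat
  assumes "squarefree d"
  shows "\<Prod>(prime_factors d) = d"
proof -
  have "d \<noteq> 0" using assms by (metis not_squarefree_0)
  then have "(\<Prod>p\<in>prime_factors d. p ^ multiplicity p d) = d"
    by (simp add: prod_prime_factors)
  moreover have "(\<Prod>p\<in>prime_factors d. p ^ multiplicity p d) = \<Prod>(prime_factors d)"
    using assms \<open>d \<noteq> 0\<close> by (intro prod.cong) (auto simp: squarefree_factorial_semiring')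
  ultimately show ?thesis by simp
qed

text \<open>
  Only squarefree divisors contribute. They correspond to the sets of prime factors of \<open>n\<close>, and the
  signed count of the subsets of a set \<open>P\<close> is the expansion of \<open>(\<Prod>p\<in>P. - 1 + 1)\<close>.
\<close>
lemma sum_mobius_mu_divisors:
  assumes "n > 0"
  shows "(\<Sum>d | d dvd n. mobius_mu d) = (if n = 1 then 1 else 0)"
proof -
  let ?P = "prime_factors n"
  have "(\<Sum>d | d dvd n. mobius_mu d) = (\<Sum>d | d dvd n \<and> squarefree d. (-1) ^ card (prime_factors d))"
    using assms by (intro sum.mono_neutral_cong_right) (auto simp: mobius_mu_def)
  also have "\<dots> = (\<Sum>S\<in>Pow ?P. (-1) ^ card S)"
  proof (rule sum.reindex_bij_witness[of _ "\<lambda>S. \<Prod>S" prime_factors])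
    fix d assume d: "d \<in> {d. d dvd n \<and> squarefree d}"
    then show "\<Prod>(prime_factors d) = d" by (simp add: squarefree_eq_prod_prime_factors)
    show "prime_factors d \<in> Pow ?P" using d assms by (auto simp: dvd_prime_factors)
  next
    fix S assume S: "S \<in> Pow ?P"
    then have fin: "finite S" and pr: "\<forall>p\<in>S. prime p"
      by (auto intro: finite_subset)
    show pf: "prime_factors (\<Prod>S) = S" by (rule prime_factors_prod_primes[OF fin pr])
    have cop: "coprime p q" if "p \<in> S" "q \<in> S" "p \<noteq> q" for p q
      using that pr by (simp add: primes_coprime)
    have "squarefree (\<Prod>S)"
      using pr cop by (intro squarefree_prod_coprime) (auto intro: squarefree_prime)
    moreover have "\<Prod>S dvd n"
      using fin S cop
    proof (induction S)
      case (insert p S)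
      have "coprime p (\<Prod>S)" using insert by (intro prod_coprime_right) auto
      then show ?case using insert by (auto intro!: divides_mult)
    qed simp
    ultimately show "\<Prod>S \<in> {d. d dvd n \<and> squarefree d}" by simp
  qed auto
  also have "\<dots> = (\<Prod>p\<in>?P. (-1) + 1)"
    by (subst prod_add) auto
  also have "\<dots> = (if n = 1 then 1 else 0)"
    using assms by (cases "n = 1") (auto simp: card_gt_0_iff prime_factorization_empty_iff)
  finally show ?thesis .
qed

text \<open>
  Exchanging the sums, with \<open>k = d e\<close>, leaves for every \<open>d\<close> the sum of the Moebius function over the
  divisors of \<open>n div d\<close>, which vanishes unless \<open>d = n\<close>.
\<close>
theorem mobius_inversion:
  fixes h :: "nat \<Rightarrow> 'a :: comm_ring_1"
  assumes "n > 0"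
  shows "(\<Sum>k | k dvd n. \<Sum>d | d dvd k. h d * of_int (mobius_mu (k div d))) = h n"
proof -
  have "(\<Sum>k | k dvd n. \<Sum>d | d dvd k. h d * of_int (mobius_mu (k div d))) =
        (\<Sum>(k, d)\<in>(SIGMA k:{k. k dvd n}. {d. d dvd k}). h d * of_int (mobius_mu (k div d)))"
    using assms by (intro sum.Sigma) (auto intro: finite_divisors_nat dvd_pos_nat)
  also have "\<dots> = (\<Sum>(d, e)\<in>(SIGMA d:{d. d dvd n}. {e. e dvd n div d}). h d * of_int (mobius_mu e))"
    using assms
    by (intro sum.reindex_bij_witness[of _ "\<lambda>(d, e). (d * e, d)" "\<lambda>(k, d). (d, k div d)"])
       (auto simp: dvd_div_iff_mult dvd_pos_nat mult.commute intro: dvd_trans dvd_mult_right elim!: dvdE)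
  also have "\<dots> = (\<Sum>d | d dvd n. \<Sum>e | e dvd n div d. h d * of_int (mobius_mu e))"
    using assms by (intro sum.Sigma[symmetric]) (auto intro!: finite_divisors_nat simp: div_greater_zero_iff dvd_imp_le)
  also have "\<dots> = (\<Sum>d | d dvd n. h d * (if n div d = 1 then 1 else 0))"
  proof (rule sum.cong[OF refl])
    fix d assume "d \<in> {d. d dvd n}"
    then have "n div d > 0" using assms by (auto simp: div_greater_zero_iff dvd_imp_le intro: dvd_pos_nat)
    then have "of_int (\<Sum>e | e dvd n div d. mobius_mu e) = (if n div d = 1 then 1 else 0 :: 'a)"
      by (simp add: sum_mobius_mu_divisors)
    then show "(\<Sum>e | e dvd n div d. h d * of_int (mobius_mu e)) = h d * (if n div d = 1 then 1 else 0)"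
      by (simp only: sum_distrib_left[symmetric] of_int_sum[symmetric])
  qed
  also have "\<dots> = (\<Sum>d\<in>{n}. h d)"
    using assms by (intro sum.mono_neutral_cong_right) (auto elim!: dvdE)
  finally show ?thesis by simp
qed

section \<open>Sums of logarithms as power series\<close>

text \<open>
  The logarithm of the product of all \<open>(1 - z\<^sup>d)\<^bsup>X d\<^esup>\<close>. It is holomorphic in the disc and vanishes
  at 0, so working with this sum instead of the product settles all questions of branches.
\<close>
definition log_product :: "(nat \<Rightarrow> complex) \<Rightarrow> complex \<Rightarrow> complex" where
  "log_product X z = (\<Sum>\<^sub>\<infinity>d\<in>{1..}. X d * Ln (1 - z ^ d))"

text \<open>The coefficients of the power series of \<open>- log_product X\<close>; the value at 0 is \<open>0 / 0 = 0\<close>.\<close>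
definition divisor_coeff :: "(nat \<Rightarrow> complex) \<Rightarrow> nat \<Rightarrow> complex" where
  "divisor_coeff X n = (\<Sum>d | d dvd n. of_nat d * X d) / of_nat n"

lemma has_sum_Ln_power:
  assumes "norm w < 1"
  shows "((\<lambda>m. w ^ m / of_nat m) has_sum (- Ln (1 - w))) {1..}"
proof -
  have s: "(\<lambda>m. w ^ m / of_nat m) sums (- Ln (1 - w))"
    using sums_minus[OF Ln_series'[of "- w"]] assms by simp
  have "summable (\<lambda>m. norm (w ^ m / of_nat m))"
  proof (rule summable_comparison_test')
    show "summable (\<lambda>m. norm w ^ m)" using assms by (simp add: summable_geometric)
    show "norm (norm (w ^ m / of_nat m)) \<le> norm w ^ m" for m
      by (cases "m = 0") (auto simp: norm_divide norm_power divide_le_eq mult_le_cancel_left1)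
  qed
  then have "((\<lambda>m. w ^ m / of_nat m) has_sum (- Ln (1 - w))) UNIV"
    using s by (rule norm_summable_imp_has_sum)
  also have "?this \<longleftrightarrow> ?thesis"
    by (rule has_sum_cong_neutral) (auto simp: not_le)
  finally show ?thesis .
qed

text \<open>
  Absolute convergence over all pairs \<open>(d, m)\<close> follows by comparison with a product of two geometric
  series, since \<open>d m \<ge> (d - 1) + (m - 1)\<close>.
\<close>
lemma abs_summable_log_double_series:
  fixes X :: "nat \<Rightarrow> complex"
  assumes X: "\<And>d. d \<ge> 1 \<Longrightarrow> norm (X d) \<le> B" and z: "norm z < 1"
  shows "(\<lambda>(d, m). X d * ((z ^ d) ^ m / of_nat m)) summable_on {1..} \<times> {1..}"
proof -
  define r where "r = norm z"
  have r: "0 \<le> r" "r < 1" using z by (auto simp: r_def)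
  have B: "B \<ge> 0" using X[of 1] norm_ge_zero[of "X 1"] by linarith
  have geo: "((\<lambda>n. r ^ (n - 1)) has_sum (1 / (1 - r))) {1..}"
  proof -
    have "((\<lambda>n. r ^ n) has_sum (1 / (1 - r))) UNIV"
      using r by (intro norm_summable_imp_has_sum geometric_sums) (auto simp: summable_geometric)
    also have "?this \<longleftrightarrow> ?thesis"
      by (rule has_sum_reindex_bij_witness[of _ "\<lambda>n. n - 1" "\<lambda>n. n + 1"]) auto
    finally show ?thesis .
  qed
  have "(\<lambda>(d, m). B * (r ^ (d - 1) * r ^ (m - 1))) summable_on {1..} \<times> {1..}"
  proof (rule summable_on_SigmaI)
    show "((\<lambda>m. case (d, m) of (d, m) \<Rightarrow> B * (r ^ (d - 1) * r ^ (m - 1)))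
             has_sum B * (r ^ (d - 1) * (1 / (1 - r)))) {1..}" for d :: nat
      using has_sum_cmult_right[OF geo, of "B * r ^ (d - 1)"] by (simp add: mult.assoc)
    show "(\<lambda>d. B * (r ^ (d - 1) * (1 / (1 - r)))) summable_on {1..}"
      by (rule summable_on_cmult_right, rule summable_on_cmult_left, rule has_sum_imp_summable[OF geo])
  qed (use B r in auto)
  then have "(\<lambda>p. norm (case p of (d, m) \<Rightarrow> X d * ((z ^ d) ^ m / of_nat m))) summable_on {1..} \<times> {1..}"
  proof (rule Infinite_Sum.abs_summable_on_comparison_test')
    fix p :: "nat \<times> nat" assume p: "p \<in> {1..} \<times> {1..}"
    then obtain d m where dm: "p = (d, m)" "d \<ge> 1" "m \<ge> 1" by auto
    have "(d - 1) + (m - 1) \<le> d * m"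
      using dm by (cases d; cases m) auto
    then have "r ^ (d * m) \<le> r ^ ((d - 1) + (m - 1))"
      using r by (intro power_decreasing) auto
    moreover have "norm ((z ^ d) ^ m / of_nat m) \<le> r ^ (d * m)"
      using dm by (simp add: norm_divide norm_power r_def power_mult divide_le_eq mult_le_cancel_left1)
    ultimately have "norm ((z ^ d) ^ m / of_nat m) \<le> r ^ (d - 1) * r ^ (m - 1)"
      by (simp add: power_add)
    then show "norm (case p of (d, m) \<Rightarrow> X d * ((z ^ d) ^ m / of_nat m))
        \<le> (case p of (d, m) \<Rightarrow> B * (r ^ (d - 1) * r ^ (m - 1)))"
      using dm X[of d] B by (simp add: norm_mult del: times_divide_eq_right) (intro mult_mono, auto)
  qed
  then show ?thesis by (rule abs_summable_summable)
qed

text \<open>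
  The same absolutely convergent double series is summed in two ways: over \<open>m\<close> for fixed \<open>d\<close>, and
  over the divisors \<open>d\<close> of a fixed \<open>n = d m\<close>.
\<close>
lemma log_product_has_sum:
  assumes X: "\<And>d. d \<ge> 1 \<Longrightarrow> norm (X d) \<le> B" and z: "norm z < 1"
  shows "((\<lambda>d. X d * Ln (1 - z ^ d)) has_sum log_product X z) {1..}"
    and "((\<lambda>n. divisor_coeff X n * z ^ n) has_sum (- log_product X z)) {1..}"
proof -
  define t where "t = (\<lambda>(d, m). X d * ((z ^ d) ^ m / of_nat m))"
  define S where "S = infsum t ({1..} \<times> {1..})"
  have "t summable_on {1..} \<times> {1..}"
    unfolding t_def using X z by (rule abs_summable_log_double_series)
  then have S: "(t has_sum S) ({1..} \<times> {1..})"
    unfolding S_def by (rule has_sum_infsum)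
  have "((\<lambda>d. - (X d * Ln (1 - z ^ d))) has_sum S) {1..}"
  proof (rule has_sum_SigmaD[OF S])
    fix d :: nat assume "d \<in> {1..}"
    then have "norm (z ^ d) < 1" using z by (simp add: norm_power power_less_one_iff)
    from has_sum_cmult_right[OF has_sum_Ln_power[OF this], of "X d"]
    show "((\<lambda>m. t (d, m)) has_sum - (X d * Ln (1 - z ^ d))) {1..}" by (simp add: t_def)
  qed
  then have *: "((\<lambda>d. X d * Ln (1 - z ^ d)) has_sum (- S)) {1..}"
    by (simp add: has_sum_uminus)
  then have S_eq: "log_product X z = - S"
    unfolding log_product_def by (rule infsumI)
  show "((\<lambda>d. X d * Ln (1 - z ^ d)) has_sum log_product X z) {1..}"
    using * by (simp add: S_eq)
  have "((\<lambda>(n, d). of_nat d * X d / of_nat n * z ^ n) has_sum S) (SIGMA n:{1..}. {d. d dvd n})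
      \<longleftrightarrow> (t has_sum S) ({1..} \<times> {1..})"
    by (rule has_sum_reindex_bij_witness[of _ "\<lambda>(d, m). (d * m, d)" "\<lambda>(n, d). (d, n div d)"])
       (auto simp: t_def power_mult elim!: dvdE)
  with S have "((\<lambda>(n, d). of_nat d * X d / of_nat n * z ^ n) has_sum S) (SIGMA n:{1..}. {d. d dvd n})"
    by blast
  then have "((\<lambda>n. divisor_coeff X n * z ^ n) has_sum S) {1..}"
  proof (rule has_sum_SigmaD)
    fix n :: nat assume "n \<in> {1..}"
    then have "finite {d. d dvd n}" by simp
    from has_sum_finite[OF this, of "\<lambda>d. of_nat d * X d / of_nat n * z ^ n"]
    show "((\<lambda>d. case (n, d) of (n, d) \<Rightarrow> of_nat d * X d / of_nat n * z ^ n)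
        has_sum divisor_coeff X n * z ^ n) {d. d dvd n}"
      by (simp add: divisor_coeff_def sum_distrib_right sum_divide_distrib)
  qed
  then show "((\<lambda>n. divisor_coeff X n * z ^ n) has_sum (- log_product X z)) {1..}"
    by (simp add: S_eq)
qed

lemma divisor_coeff_sums:
  assumes X: "\<And>d. d \<ge> 1 \<Longrightarrow> norm (X d) \<le> B" and z: "norm z < 1"
  shows "(\<lambda>n. divisor_coeff X n * z ^ n) sums (- log_product X z)"
proof -
  have "((\<lambda>n. divisor_coeff X n * z ^ n) has_sum (- log_product X z)) UNIV
     \<longleftrightarrow> ((\<lambda>n. divisor_coeff X n * z ^ n) has_sum (- log_product X z)) {1..}"
    by (rule has_sum_cong_neutral) (auto simp: not_le divisor_coeff_def)
  then show ?thesis using log_product_has_sum(2)[of X B, OF X z] has_sum_imp_sums by blast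
qed

lemma log_product_holomorphic:
  assumes X: "\<And>d. d \<ge> 1 \<Longrightarrow> norm (X d) \<le> B"
  shows "log_product X holomorphic_on ball 0 1"
proof (rule power_series_holomorphic[where a = "\<lambda>n. - divisor_coeff X n"])
  fix z :: complex assume "z \<in> ball 0 1"
  then have "norm z < 1" by simp
  with X have "(\<lambda>n. divisor_coeff X n * z ^ n) sums (- log_product X z)"
    by (rule divisor_coeff_sums)
  from sums_minus[OF this]
  show "(\<lambda>n. - divisor_coeff X n * (z - 0) ^ n) sums log_product X z"
    by (simp only: mult_minus_left diff_0_right minus_minus)
qed

lemma log_product_0 [simp]: "log_product X 0 = 0"
  unfolding log_product_def
proof (rule infsum_0)
  fix d :: nat assume "d \<in> {1..}"
  then have "(0 :: complex) ^ d = 0" by simp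
  then show "X d * Ln (1 - 0 ^ d) = 0" by (simp only: diff_zero Ln_1 mult_zero_right)
qed

lemma log_product_real:
  assumes X: "\<And>d. d \<ge> 1 \<Longrightarrow> norm (X d) \<le> B" and r: "\<And>d. d \<ge> 1 \<Longrightarrow> X d \<in> \<real>" and q: "\<bar>q :: real\<bar> < 1"
  shows "log_product X (of_real q) \<in> \<real>"
proof -
  have "X d * Ln (1 - of_real q ^ d) = of_real (Re (X d) * ln (1 - q ^ d))" if "d \<ge> 1" for d
  proof -
    have "\<bar>q ^ d\<bar> < 1" using q that by (simp add: power_abs power_less_one_iff)
    then have "Ln (of_real (1 - q ^ d)) = of_real (ln (1 - q ^ d))"
      by (intro Ln_of_real) auto
    then show ?thesis using r[OF that] by (auto elim!: Reals_cases)
  qed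
  then have Im_0: "Im (X d * Ln (1 - of_real q ^ d)) = 0" if "d \<in> {1..}" for d
    using that by simp
  have "((\<lambda>d. X d * Ln (1 - of_real q ^ d)) has_sum log_product X (of_real q)) {1..}"
    using q by (intro log_product_has_sum(1)[of X B, OF X]) auto
  then have "((\<lambda>d. Im (X d * Ln (1 - of_real q ^ d))) has_sum Im (log_product X (of_real q))) {1..}"
    by (rule has_sum_bounded_linear[OF bounded_linear_Im, unfolded o_def])
  moreover have "((\<lambda>d. Im (X d * Ln (1 - of_real q ^ d))) has_sum 0) {1..}"
    by (rule has_sum_0) (rule Im_0)
  ultimately have "Im (log_product X (of_real q)) = 0"
    by (rule has_sum_unique)
  then show ?thesis by (simp add: complex_is_Real_iff)
qed

section \<open>The function behind its Moebius coefficients\<close>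

text \<open>
  The Moebius coefficients are made for this: inverting the convolution recovers the Taylor
  coefficients of \<open>f\<close>. The constant term is where \<open>f 0 = 0\<close> enters.
\<close>
lemma divisor_coeff_mobius_coeff:
  assumes "f 0 = 0"
  shows "divisor_coeff (mobius_coeff f) n = (deriv ^^ n) f 0 / fact n"
proof (cases "n = 0")
  case False
  define h where "h d = (deriv ^^ d) f 0 / Gamma (of_nat d)" for d
  have "(\<Sum>d | d dvd n. of_nat d * mobius_coeff f d) =
        (\<Sum>k | k dvd n. \<Sum>d | d dvd k. h d * of_int (mobius_mu (k div d)))"
    using False by (intro sum.cong) (auto simp: mobius_coeff_def h_def)
  also have "\<dots> = h n" using False by (intro mobius_inversion) auto
  finally have "divisor_coeff (mobius_coeff f) n = h n / of_nat n"
    by (simp add: divisor_coeff_def)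
  moreover have "Gamma (of_nat n :: complex) * of_nat n = fact n"
    using False Gamma_fact[of "n - 1", where ?'a = complex] by (cases n) (auto simp: mult.commute)
  ultimately show ?thesis by (simp add: h_def)
qed (simp add: divisor_coeff_def assms)

text \<open>
  Both sides have the same Taylor series at 0, so they agree near 0; the right-hand side is holomorphic
  in the whole disc, and the identity theorem carries the equation over to \<open>U\<close>.
\<close>
theorem eq_neg_log_product_mobius_coeff:
  assumes f: "f holomorphic_on U" "open U" "connected U" "0 \<in> U" "U \<subseteq> ball 0 1" "f 0 = 0"
    and X: "\<And>d. d \<ge> 1 \<Longrightarrow> norm (mobius_coeff f d) \<le> B" and z: "z \<in> U"
  shows "f z = - log_product (mobius_coeff f) z"
proof -
  obtain r where r: "r > 0" "ball 0 r \<subseteq> U" using f open_contains_ball by blast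
  have near: "f w = - log_product (mobius_coeff f) w" if w: "w \<in> ball 0 r" for w
  proof -
    have "f holomorphic_on ball 0 r" using f(1) r(2) by (rule holomorphic_on_subset)
    from holomorphic_power_series[OF this w]
    have "(\<lambda>n. divisor_coeff (mobius_coeff f) n * w ^ n) sums f w"
      by (simp add: divisor_coeff_mobius_coeff[of f, OF f(6)])
    moreover have "(\<lambda>n. divisor_coeff (mobius_coeff f) n * w ^ n) sums (- log_product (mobius_coeff f) w)"
    proof (rule divisor_coeff_sums[OF X])
      have "w \<in> ball 0 1" using w r f(5) by blast
      then show "norm w < 1" by simp
    qed
    ultimately show ?thesis by (rule sums_unique2)
  qed
  show ?thesis
  proof (rule analytic_continuation_open[of "ball 0 r" U f])
    have "log_product (mobius_coeff f) holomorphic_on ball 0 1"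
      using X by (rule log_product_holomorphic)
    then show "(\<lambda>z. - log_product (mobius_coeff f) z) holomorphic_on U"
      using f by (auto intro!: holomorphic_intros elim: holomorphic_on_subset)
  qed (use f r near z in auto)
qed

section \<open>Products over residue classes and catoptric sequences\<close>

definition residue_indicator :: "nat \<Rightarrow> nat \<Rightarrow> nat \<Rightarrow> complex" where
  "residue_indicator T k d = of_bool (d mod T = k mod T)"

lemma norm_residue_indicator_le: "norm (residue_indicator T k d) \<le> 1"
  by (simp add: residue_indicator_def)

abbreviation log_residue_product :: "nat \<Rightarrow> nat \<Rightarrow> complex \<Rightarrow> complex" where
  "log_residue_product T k \<equiv> log_product (residue_indicator T k)"

text \<open>
  The residue class of 0 is represented by \<open>k = T\<close>, so that \<open>n T + k\<close> with \<open>n \<ge> 0\<close> enumerates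
  exactly the positive numbers of the class.
\<close>
lemma log_residue_product_sums:
  assumes k: "1 \<le> k" "k \<le> T" and z: "norm z < 1"
  shows "(\<lambda>n. Ln (1 - z ^ (n * T + k))) sums log_residue_product T k z"
proof -
  have ge: "k \<le> d" if "d \<ge> 1" "d mod T = k mod T" for d
  proof (rule ccontr)
    assume "\<not> k \<le> d"
    then have "d mod T = d" "d < k" using k by auto
    then show False using that k by (cases "k = T") auto
  qed
  have "((\<lambda>d. residue_indicator T k d * Ln (1 - z ^ d)) has_sum log_residue_product T k z) {1..}"
    by (rule log_product_has_sum(1)[OF norm_residue_indicator_le z])
  also have "?this \<longleftrightarrow> ((\<lambda>d. Ln (1 - z ^ d)) has_sum log_residue_product T k z) {d. d \<ge> 1 \<and> d mod T = k mod T}"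
    by (rule has_sum_cong_neutral) (auto simp: residue_indicator_def)
  also have "\<dots> \<longleftrightarrow> ((\<lambda>n. Ln (1 - z ^ (n * T + k))) has_sum log_residue_product T k z) UNIV"
  proof (rule has_sum_reindex_bij_witness[of _ "\<lambda>n. n * T + k" "\<lambda>d. (d - k) div T"])
    fix d assume d: "d \<in> {d. d \<ge> 1 \<and> d mod T = k mod T}"
    then have "k \<le> d" "d mod T = k mod T" using ge[of d] by auto
    then have "T dvd d - k" by (simp add: mod_eq_dvd_iff_nat)
    then show eq: "(d - k) div T * T + k = d" using d ge[of d] by auto
    show "Ln (1 - z ^ ((d - k) div T * T + k)) = Ln (1 - z ^ d)" by (simp only: eq)
  qed (use k in auto)
  finally show ?thesis by (rule has_sum_imp_sums)
qed

lemma residue_product_has_prod: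
  assumes k: "1 \<le> k" "k \<le> T" and z: "norm z < 1"
  shows "(\<lambda>n. 1 - z ^ (n * T + k)) has_prod exp (log_residue_product T k z)"
proof -
  have "exp (Ln (1 - z ^ (n * T + k))) = 1 - z ^ (n * T + k)" for n
  proof (rule exp_Ln)
    have "norm (z ^ (n * T + k)) < 1"
      using k z by (simp add: norm_power power_less_one_iff)
    then show "1 - z ^ (n * T + k) \<noteq> 0" by auto
  qed
  then show ?thesis
    using sums_imp_has_prod_exp[OF log_residue_product_sums[OF assms]] by (simp add: has_prod_def)
qed

lemma eta_q_power:
  assumes T: "T > 0" and z: "norm z < 1"
  shows "eta_q (z ^ T) = exp (log_residue_product T T z)"
proof -
  have "(\<lambda>n. 1 - (z ^ T) ^ Suc n) has_prod exp (log_residue_product T T z)"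
    using residue_product_has_prod[of T T z] T z
    by (simp add: power_mult[symmetric] power_add[symmetric] algebra_simps)
  then show ?thesis by (simp only: eta_q_def has_prod_iff)
qed

lemma log_residue_product_real:
  "\<bar>q :: real\<bar> < 1 \<Longrightarrow> log_residue_product T k (of_real q) \<in> \<real>"
  by (rule log_product_real[OF norm_residue_indicator_le]) (auto simp: residue_indicator_def)

lemma log_residue_product_holomorphic: "log_residue_product T k holomorphic_on ball 0 1"
  by (rule log_product_holomorphic[OF norm_residue_indicator_le])

text \<open>
  Symmetry leaves three kinds of residues \<open>m\<close> of \<open>d\<close>: \<open>0\<close>, where \<open>X T = 0\<close>; the middle \<open>2 m = T\<close>,
  where the value is 0 by assumption; and all others, for which exactly one of \<open>m\<close> and \<open>T - m\<close>
  lies in the range of summation.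
\<close>
lemma catoptric_decomposition:
  fixes X :: "nat \<Rightarrow> complex"
  assumes T: "0 < T" and X: "catoptric T X" and even: "even T \<longrightarrow> X (T div 2) = 0" and d: "d \<ge> 1"
  shows "X d = (\<Sum>j = 1..(T - 1) div 2. X j * (residue_indicator T j d + residue_indicator T (T - j) d))"
proof -
  define m where "m = d mod T"
  have m: "m < T" using T by (simp add: m_def)
  have per: "X (k + n * T) = X k" if "k \<ge> 1" for k n
    using X that by (auto simp: catoptric_def periodic_seq_def)
  have sym: "X j = X (T - j)" if "j \<in> {1..(T - 1) div 2}" for j
    using X that by (auto simp: catoptric_def)
  have ind: "residue_indicator T j d + residue_indicator T (T - j) d = of_bool (j = m) + of_bool (j = T - m)"
    if "j \<in> {1..(T - 1) div 2}" for j
    using that m by (auto simp: residue_indicator_def m_def[symmetric])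
  have "(\<Sum>j = 1..(T - 1) div 2. X j * (residue_indicator T j d + residue_indicator T (T - j) d))
      = (\<Sum>j = 1..(T - 1) div 2. X j * (of_bool (j = m) + of_bool (j = T - m)))"
    by (intro sum.cong refl) (simp only: ind)
  also have "\<dots> = X d"
  proof (cases "m = 0")
    case True
    then obtain n where n: "d = n * T" using T unfolding m_def by (auto elim!: dvdE simp: mod_eq_0_iff_dvd mult.commute)
    then have "d = T + (n - 1) * T" using d by (cases n) auto
    then have "X d = X T" using per[of T "n - 1"] T by simp
    also have "\<dots> = 0" using X by (simp add: catoptric_def)
    finally show ?thesis using True T by (auto intro!: sum.neutral)
  next
    case False
    have "d = m + (d div T) * T" by (simp add: m_def)
    then have Xd: "X d = X m" using per[of m "d div T"] False by simp
    consider "m \<le> (T - 1) div 2" | "2 * m = T" | "(T - 1) div 2 < m" "T - m \<le> (T - 1) div 2" using m by linarith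
    then show ?thesis
    proof cases
      case 1
      then have "(\<Sum>j = 1..(T - 1) div 2. X j * (of_bool (j = m) + of_bool (j = T - m))) = (\<Sum>j\<in>{m}. X j)"
        using False T by (intro sum.mono_neutral_cong_right) auto
      then show ?thesis using Xd by simp
    next
      case 2
      then have "(\<Sum>j = 1..(T - 1) div 2. X j * (of_bool (j = m) + of_bool (j = T - m))) = 0"
        by (intro sum.neutral) auto
      then show ?thesis using Xd even 2 by auto
    next
      case 3
      then have "(\<Sum>j = 1..(T - 1) div 2. X j * (of_bool (j = m) + of_bool (j = T - m))) = (\<Sum>j\<in>{T - m}. X j)"
        using m by (intro sum.mono_neutral_cong_right) auto
      then show ?thesis using Xd sym[of "T - m"] 3 m by simp
    qed
  qed
  finally show ?thesis by simp
qed

lemma catoptric_bounded: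
  fixes X :: "nat \<Rightarrow> complex"
  assumes "0 < T" "catoptric T X" "even T \<longrightarrow> X (T div 2) = 0"
  obtains B where "\<And>d. d \<ge> 1 \<Longrightarrow> norm (X d) \<le> B"
proof
  fix d :: nat assume "d \<ge> 1"
  show "norm (X d) \<le> (\<Sum>j = 1..(T - 1) div 2. norm (X j) * (1 + 1))"
    by (subst catoptric_decomposition[OF assms \<open>d \<ge> 1\<close>], intro sum_norm_le, subst norm_mult,
        intro mult_left_mono norm_triangle_le add_mono norm_residue_indicator_le) auto
qed

lemma has_sum_sum:
  fixes f :: "'i \<Rightarrow> 'a \<Rightarrow> 'b :: topological_comm_monoid_add"
  assumes "\<And>i. i \<in> I \<Longrightarrow> (f i has_sum s i) A"
  shows "((\<lambda>x. \<Sum>i\<in>I. f i x) has_sum (\<Sum>i\<in>I. s i)) A"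
  using assms by (induction I rule: infinite_finite_induct) (auto intro!: has_sum_add)

lemma log_product_catoptric:
  fixes X :: "nat \<Rightarrow> complex"
  assumes X: "0 < T" "catoptric T X" "even T \<longrightarrow> X (T div 2) = 0" and z: "norm z < 1"
  shows "log_product X z =
    (\<Sum>j = 1..(T - 1) div 2. X j * (log_residue_product T j z + log_residue_product T (T - j) z))"
proof -
  have "((\<lambda>d. \<Sum>j = 1..(T - 1) div 2. X j *
            (residue_indicator T j d * Ln (1 - z ^ d) + residue_indicator T (T - j) d * Ln (1 - z ^ d)))
         has_sum (\<Sum>j = 1..(T - 1) div 2. X j * (log_residue_product T j z + log_residue_product T (T - j) z))) {1..}"
    by (intro has_sum_sum has_sum_cmult_right has_sum_add log_product_has_sum(1)[OF norm_residue_indicator_le z])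
  also have "?this \<longleftrightarrow> ((\<lambda>d. X d * Ln (1 - z ^ d)) has_sum
      (\<Sum>j = 1..(T - 1) div 2. X j * (log_residue_product T j z + log_residue_product T (T - j) z))) {1..}"
  proof (rule has_sum_cong)
    fix d :: nat assume "d \<in> {1..}"
    then have "d \<ge> 1" by simp
    show "(\<Sum>j = 1..(T - 1) div 2. X j *
            (residue_indicator T j d * Ln (1 - z ^ d) + residue_indicator T (T - j) d * Ln (1 - z ^ d)))
        = X d * Ln (1 - z ^ d)"
      unfolding catoptric_decomposition[OF X \<open>d \<ge> 1\<close>] sum_distrib_right
      by (rule sum.cong) (simp_all only: ring_distribs mult.assoc)
  qed
  finally show ?thesis unfolding log_product_def[of X] by (rule infsumI)
qed

section \<open>The finite Jacobi triple product\<close>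

text \<open>
  This is \<open>(1 - Q)\<^sup>n\<close> times the usual q-factorial; in this normalisation the sequence converges to the
  eta product.
\<close>
definition q_factorial :: "complex \<Rightarrow> nat \<Rightarrow> complex" where
  "q_factorial Q n = (\<Prod>k<n. 1 - Q ^ Suc k)"

lemma one_minus_power_nonzero:
  fixes Q :: complex
  assumes "norm Q < 1" "n > 0"
  shows "1 - Q ^ n \<noteq> 0"
proof
  assume "1 - Q ^ n = 0"
  then have "norm (Q ^ n) = 1" by simp
  moreover have "norm (Q ^ n) < 1"
    using assms power_less_one_iff[of "norm Q" n] by (simp add: norm_power power_less_one_iff)
  ultimately show False by simp
qed

lemma q_factorial_nonzero: "norm Q < 1 \<Longrightarrow> q_factorial Q n \<noteq> 0"
  unfolding q_factorial_def using one_minus_power_nonzero[of Q] by (auto simp del: power_Suc)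

lemma q_factorial_0 [simp]: "q_factorial Q 0 = 1"
  by (simp add: q_factorial_def)

lemma q_factorial_Suc: "q_factorial Q (Suc n) = q_factorial Q n * (1 - Q ^ Suc n)"
  by (simp add: q_factorial_def)

definition q_binomial :: "complex \<Rightarrow> nat \<Rightarrow> nat \<Rightarrow> complex" where
  "q_binomial Q n k = q_factorial Q n / (q_factorial Q k * q_factorial Q (n - k))"

lemma q_binomial_Suc_Suc:
  assumes "norm Q < 1" "j < M"
  shows "q_binomial Q (Suc M) (Suc j) = q_binomial Q M (Suc j) + q_binomial Q M j * Q ^ (M - j)"
proof -
  define m where "m = M - Suc j"
  have M: "M = Suc (j + m)" using assms by (simp add: m_def)
  have nz: "q_factorial Q n \<noteq> 0" for n by (rule q_factorial_nonzero[OF assms(1)])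
  have nz': "1 - Q * Q ^ n \<noteq> 0" for n using one_minus_power_nonzero[OF assms(1), of "Suc n"] by simp
  show ?thesis
    using nz nz' unfolding M q_binomial_def
    by (simp add: Suc_diff_le q_factorial_Suc divide_simps) (simp add: algebra_simps power_add)
qed

text \<open>
  By induction on \<open>M\<close>: multiplication by \<open>1 + y Q\<^sup>M\<close> acts on the coefficients as the Pascal rule
  \<open>q_binomial_Suc_Suc\<close>.
\<close>
theorem q_binomial_theorem:
  assumes "norm Q < 1"
  shows "(\<Prod>k<M. 1 + y * Q ^ k) = (\<Sum>k\<le>M. q_binomial Q M k * Q ^ (k * (k - 1) div 2) * y ^ k)"
proof (induction M)
  case 0
  show ?case by (simp add: q_binomial_def)
next
  case (Suc M)
  have nz: "q_factorial Q n \<noteq> 0" for n by (rule q_factorial_nonzero[OF assms(1)])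
  define e where "e k = Q ^ (k * (k - 1) div 2)" for k :: nat
  have e_Suc: "e (Suc k) = e k * Q ^ k" for k
  proof -
    have "Suc k * (Suc k - 1) = k * (k - 1) + k * 2" by (cases k) auto
    then have "Suc k * (Suc k - 1) div 2 = k * (k - 1) div 2 + k" by simp
    then show ?thesis by (simp only: e_def power_add)
  qed
  have q0: "q_binomial Q n 0 = 1" and qn: "q_binomial Q n n = 1" for n
    using nz by (auto simp: q_binomial_def)
  define c where "c k = q_binomial Q M k * e k" for k
  have step: "q_binomial Q (Suc M) (Suc k) * e (Suc k) = (if k < M then c (Suc k) else 0) + c k * Q ^ M"
    if "k \<le> M" for k
  proof (cases "k < M")
    case True
    have "Q ^ M = Q ^ k * Q ^ (M - k)" using True by (simp flip: power_add)
    then show ?thesis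
      using True q_binomial_Suc_Suc[OF assms True]
      by (simp add: c_def e_Suc algebra_simps)
  next
    case False
    then have "k = M" using that by simp
    then show ?thesis by (simp add: c_def qn e_Suc)
  qed
  have "(\<Sum>k\<le>Suc M. q_binomial Q (Suc M) k * e k * y ^ k) =
        1 + (\<Sum>k\<le>M. ((if k < M then c (Suc k) else 0) + c k * Q ^ M) * y ^ Suc k)"
    by (subst sum.atMost_Suc_shift) (simp add: q0 step e_def[of 0] del: power_Suc)
  also have "\<dots> = (1 + (\<Sum>k\<le>M. (if k < M then c (Suc k) * y ^ Suc k else 0))) + y * Q ^ M * (\<Sum>k\<le>M. c k * y ^ k)"
    unfolding sum_distrib_left add.assoc sum.distrib[symmetric]
    by (intro arg_cong[where f = "(+) 1"] sum.cong) (auto simp: algebra_simps)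
  also have "(\<Sum>k\<le>M. (if k < M then c (Suc k) * y ^ Suc k else 0)) = (\<Sum>k<M. c (Suc k) * y ^ Suc k)"
    by (intro sum.mono_neutral_cong_right) auto
  also have "1 + \<dots> = (\<Sum>k<Suc M. c k * y ^ k)"
    by (subst sum.lessThan_Suc_shift) (simp add: c_def q0 e_def)
  also have "\<dots> = (\<Sum>k\<le>M. c k * y ^ k)" by (simp add: lessThan_Suc_atMost)
  also have "\<dots> + y * Q ^ M * \<dots> = (\<Prod>k<Suc M. 1 + y * Q ^ k)"
    using Suc.IH by (simp add: c_def e_def algebra_simps)
  finally show ?case by (simp add: e_def)
qed

text \<open>
  The terms of the bilateral series in the triple product. The exponent \<open>n (n - 1) / 2\<close> of \<open>Q\<close> is
  a non-negative integer for every integer \<open>n\<close>.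
\<close>
definition theta_term :: "complex \<Rightarrow> complex \<Rightarrow> int \<Rightarrow> complex" where
  "theta_term Q x n = (- x) powi n * Q powi (n * (n - 1) div 2)"

lemma theta_term_Suc:
  assumes "Q \<noteq> 0" "x \<noteq> 0"
  shows "theta_term Q x (n + 1) = theta_term Q x n * (- x) * Q powi n"
proof -
  have "(n + 1) * (n + 1 - 1) = n * (n - 1) + n * 2" by (simp add: algebra_simps)
  then have "(n + 1) * (n + 1 - 1) div 2 = n * (n - 1) div 2 + n" by simp
  then show ?thesis
    using assms by (simp add: theta_term_def power_int_add)
qed

text \<open>
  This is the q-binomial theorem for \<open>2 N\<close> factors at \<open>y = - x / Q\<^sup>N\<close>. The second half of the factors is
  the product of the \<open>1 - x Q\<^sup>k\<close>. Pulling \<open>- x / Q\<^bsup>k + 1\<^esup>\<close> out of each factor of the first half leaves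
  the product of the \<open>1 - Q\<^bsup>k + 1\<^esup> / x\<close>, and the product \<open>C\<close> of what was pulled out is exactly what
  recentres the sum at \<open>k = N\<close>.
\<close>
lemma finite_jacobi_triple_product:
  assumes "norm Q < 1" "Q \<noteq> 0" "x \<noteq> 0"
  shows "(\<Prod>k<N. 1 - x * Q ^ k) * (\<Prod>k<N. 1 - Q ^ Suc k / x) =
         (\<Sum>k\<le>2 * N. q_binomial Q (2 * N) k * theta_term Q x (int k - int N))"
proof -
  define C where "C N = (\<Prod>k<N. - x / Q ^ Suc k)" for N
  define y where "y = - x / Q ^ N"
  have C0: "C N \<noteq> 0" using assms by (auto simp: C_def)
  have base: "C N * theta_term Q x (- int N) = 1"
  proof (induction N)
    case (Suc N)
    \<comment> \<open>one step down in \<open>n\<close> compensates the new factor of \<open>C\<close>\<close>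
    have "theta_term Q x (- int N) = theta_term Q x (- int (Suc N)) * (- x) * Q powi (- int (Suc N))"
      using theta_term_Suc[OF assms(2,3), of "- int (Suc N)"] by simp
    also have "Q powi (- int (Suc N)) = 1 / Q ^ Suc N"
      by (simp only: power_int_minus power_int_of_nat inverse_eq_divide)
    finally show ?case using Suc.IH by (simp add: C_def field_simps)
  qed (simp add: C_def theta_term_def)
  have coeff: "Q ^ (k * (k - 1) div 2) * y ^ k = C N * theta_term Q x (int k - int N)" for k
  proof (induction k)
    case 0
    show ?case using base by simp
  next
    case (Suc k)
    have "Suc k * (Suc k - 1) = k * (k - 1) + k * 2" by (cases k) auto
    then have "Suc k * (Suc k - 1) div 2 = k * (k - 1) div 2 + k" by simp
    then have "Q ^ (Suc k * (Suc k - 1) div 2) * y ^ Suc k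
             = (Q ^ (k * (k - 1) div 2) * y ^ k) * (Q ^ k * y)"
      by (simp only: power_add power_Suc mult_ac)
    also have "\<dots> = C N * (theta_term Q x (int k - int N) * (- x) * Q powi (int k - int N))"
      unfolding Suc.IH using assms by (simp add: y_def power_int_diff)
    also have "\<dots> = C N * theta_term Q x ((int k - int N) + 1)"
      by (simp only: theta_term_Suc[OF assms(2,3)])
    finally show ?case by (simp add: algebra_simps)
  qed
  have split: "(\<Prod>k<N + M. f k) = (\<Prod>k<N. f k) * (\<Prod>k<M. f (k + N))" for M and f :: "nat \<Rightarrow> complex"
    by (induction M) (simp_all add: ac_simps)
  have "C N * (\<Sum>k\<le>2 * N. q_binomial Q (2 * N) k * theta_term Q x (int k - int N))
        = (\<Sum>k\<le>2*N. q_binomial Q (2*N) k * Q ^ (k * (k - 1) div 2) * y ^ k)"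
    unfolding sum_distrib_left by (intro sum.cong refl) (simp only: coeff mult.assoc, simp add: mult_ac)
  also have "\<dots> = (\<Prod>k<2*N. 1 + y * Q ^ k)"
    by (rule q_binomial_theorem[OF assms(1), symmetric])
  also have "\<dots> = (\<Prod>k<N. 1 + y * Q ^ k) * (\<Prod>k<N. 1 + y * Q ^ (k + N))"
    unfolding mult_2 by (rule split)
  also have "(\<Prod>k<N. 1 + y * Q ^ (k + N)) = (\<Prod>k<N. 1 - x * Q ^ k)"
    using assms by (simp add: y_def power_add)
  also have "(\<Prod>k<N. 1 + y * Q ^ k) = (\<Prod>k<N. 1 + y * Q ^ (N - Suc k))"
    by (rule prod.nat_diff_reindex[symmetric])
  also have "\<dots> = (\<Prod>k<N. (- x / Q ^ Suc k) * (1 - Q ^ Suc k / x))"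
  proof (rule prod.cong[OF refl])
    fix k assume "k \<in> {..<N}"
    then have "Q ^ N = Q ^ (N - Suc k) * Q ^ Suc k" by (simp flip: power_add del: power_Suc)
    then show "1 + y * Q ^ (N - Suc k) = (- x / Q ^ Suc k) * (1 - Q ^ Suc k / x)"
      using assms by (simp add: y_def field_simps)
  qed
  also have "\<dots> = C N * (\<Prod>k<N. 1 - Q ^ Suc k / x)"
    by (simp only: C_def prod.distrib)
  finally show ?thesis using C0 by (simp add: mult_ac)
qed

section \<open>Passing to the limit in the triple product\<close>

text \<open>
  Dominated convergence for sums: the finite partial sums converge uniformly in \<open>n\<close> by the
  Weierstrass test, so the two limits may be exchanged.
\<close>
lemma tannery:
  fixes f :: "nat \<Rightarrow> 'a \<Rightarrow> 'b :: banach"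
  assumes bound: "\<And>n x. x \<in> A \<Longrightarrow> norm (f n x) \<le> M x" and M: "M summable_on A"
    and lim: "\<And>x. x \<in> A \<Longrightarrow> (\<lambda>n. f n x) \<longlonglongrightarrow> g x"
  shows "(\<lambda>n. \<Sum>\<^sub>\<infinity>x\<in>A. f n x) \<longlonglongrightarrow> (\<Sum>\<^sub>\<infinity>x\<in>A. g x)"
proof (rule swap_uniform_limit'[where F = "finite_subsets_at_top A" and S = UNIV])
  show "uniform_limit UNIV (\<lambda>B n. \<Sum>x\<in>B. f n x) (\<lambda>n. \<Sum>\<^sub>\<infinity>x\<in>A. f n x) (finite_subsets_at_top A)"
    using bound M by (intro Weierstrass_m_test_general)
  show "\<forall>\<^sub>F B in finite_subsets_at_top A. (\<lambda>n. \<Sum>x\<in>B. f n x) \<longlonglongrightarrow> (\<Sum>x\<in>B. g x)"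
    using lim by (intro eventually_finite_subsets_at_top_weakI tendsto_sum) auto
  have "norm (g x) \<le> M x" if "x \<in> A" for x
    using tendsto_norm[OF lim[OF that]] bound[OF that] by (intro Lim_bounded[where M = 0]) auto
  then have "(\<lambda>x. norm (g x)) summable_on A"
    using M by (intro Infinite_Sum.abs_summable_on_comparison_test'[where g = M]) auto
  then show "(sum g \<longlongrightarrow> (\<Sum>\<^sub>\<infinity>x\<in>A. g x)) (finite_subsets_at_top A)"
    using abs_summable_summable has_sum_infsum unfolding has_sum_def by blast
qed auto

lemma summable_on_power_nat_abs_int:
  fixes r :: real
  assumes "0 \<le> r" "r < 1"
  shows "(\<lambda>n::int. r ^ nat \<bar>n\<bar>) summable_on UNIV"
proof -
  have geo: "(\<lambda>n. r ^ n) summable_on (UNIV :: nat set)"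
    using assms by (intro norm_summable_imp_summable_on) (simp add: summable_geometric)
  have pos: "(\<lambda>n::int. r ^ nat \<bar>n\<bar>) summable_on range int"
    using geo by (subst summable_on_reindex) (auto simp: o_def)
  have neg: "(\<lambda>n::int. r ^ nat \<bar>n\<bar>) summable_on range (\<lambda>n. - int n)"
    using geo by (subst summable_on_reindex) (auto simp: o_def inj_on_def)
  have "(UNIV :: int set) = range int \<union> (range (\<lambda>n. - int n) - range int)"
    by (auto simp: image_iff) (metis int_cases2)
  moreover have "(\<lambda>n::int. r ^ nat \<bar>n\<bar>) summable_on (range int \<union> (range (\<lambda>n. - int n) - range int))"
    by (rule summable_on_Un_disjoint[OF pos summable_on_subset_banach[OF neg]]) auto
  ultimately show ?thesis by simp
qed

text \<open>
  In the annulus \<open>norm Q < norm x < 1\<close> the quadratic exponent is only used through its sign: the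
  terms are dominated by powers of \<open>x\<close> on the right and by powers of \<open>Q / x\<close> on the left.
\<close>
lemma norm_theta_term_le:
  assumes "Q \<noteq> 0" "norm Q < norm x" "norm x < 1"
  shows "norm (theta_term Q x n) \<le> max (norm x) (norm Q / norm x) ^ nat \<bar>n\<bar>"
proof -
  define r where "r = max (norm x) (norm Q / norm x)"
  have r: "norm x \<le> r" "norm Q / norm x \<le> r" by (auto simp: r_def)
  have Q1: "norm Q < 1" and x0: "norm x > 0"
    using assms norm_ge_zero[of Q] by linarith+
  show ?thesis
  proof (cases "n \<ge> 0")
    case True
    then obtain m where n: "n = int m" using nonneg_int_cases by blast
    have "norm (Q powi (n * (n - 1) div 2)) \<le> 1"
    proof -
      have "n * (n - 1) \<ge> 0" using True by (cases "n = 0") auto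
      then obtain l where "n * (n - 1) div 2 = int l"
        by (metis nonneg_int_cases pos_imp_zdiv_nonneg_iff zero_less_numeral)
      then show ?thesis using Q1 by (simp add: norm_power power_le_one)
    qed
    then have "norm (theta_term Q x n) \<le> norm x ^ m * 1"
      unfolding theta_term_def norm_mult n
      by (intro mult_mono) (auto simp: norm_power)
    also have "\<dots> \<le> r ^ m" using r by (simp add: power_mono)
    finally show ?thesis by (simp add: n r_def)
  next
    case False
    define m where "m = nat (- n)"
    have n: "n = - int m" and m: "m > 0" using False by (auto simp: m_def)
    \<comment> \<open>split off \<open>m\<close> copies of \<open>Q\<close>, to be paired with the \<open>m\<close> copies of \<open>1 / x\<close>\<close>
    have "n * (n - 1) = 2 * int m + int m * (int m - 1)"
      by (simp add: n algebra_simps)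
    then have e: "n * (n - 1) div 2 = int m + int m * (int m - 1) div 2" by simp
    obtain l where l: "int m * (int m - 1) div 2 = int l"
    proof -
      have "int m * (int m - 1) \<ge> 0" using m by simp
      then show ?thesis using that
        by (metis nonneg_int_cases pos_imp_zdiv_nonneg_iff zero_less_numeral)
    qed
    have "theta_term Q x n = inverse ((- x) ^ m) * (Q ^ m * Q ^ l)"
      unfolding theta_term_def e l using assms
      by (simp add: n power_int_minus power_int_add)
    then have "norm (theta_term Q x n) = (norm Q / norm x) ^ m * norm Q ^ l"
      using x0 by (simp only: norm_mult norm_inverse norm_power norm_minus_cancel) (simp add: field_simps)
    also have "\<dots> \<le> (norm Q / norm x) ^ m * 1"
      using Q1 by (intro mult_left_mono) (auto simp: power_le_one)
    also have "\<dots> \<le> r ^ m" using r by (simp add: power_mono)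
    finally show ?thesis by (simp add: n r_def)
  qed
qed

text \<open>
  Multiply the finite version by the q-factorial of \<open>N\<close>. The coefficient of the \<open>n\<close>-th term becomes
  \<open>[N]! [2N]! / ([N + n]! [N - n]!)\<close>, which is bounded and tends to \<open>E E / (E E) = 1\<close>, so
  the theorem of Tannery gives the limit.
\<close>
theorem jacobi_triple_product:
  assumes Q: "Q \<noteq> 0" "norm Q < norm x" and x: "norm x < 1"
    and E: "(\<lambda>k. 1 - Q ^ Suc k) has_prod E"
    and A: "(\<lambda>k. 1 - x * Q ^ k) has_prod A"
    and B: "(\<lambda>k. 1 - Q ^ Suc k / x) has_prod B"
  shows "(theta_term Q x has_sum E * A * B) UNIV"
proof -
  have Q1: "norm Q < 1" using Q x by linarith
  have x0: "x \<noteq> 0" using Q norm_ge_zero[of Q] by auto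
  define r where "r = max (norm x) (norm Q / norm x)"
  have r: "0 \<le> r" "r < 1" using Q x x0 by (auto simp: r_def le_max_iff_disj)
  have lim_E: "q_factorial Q \<longlonglongrightarrow> E"
    unfolding q_factorial_def using has_prod_imp_tendsto'[OF E] .
  have E0: "E \<noteq> 0"
    unfolding has_prod_eq_0_iff[OF E] using one_minus_power_nonzero[OF Q1, of "Suc _"] by (auto simp del: power_Suc)
  obtain K where K: "\<And>n. norm (q_factorial Q n) \<le> K"
    using convergent_imp_Bseq[OF convergentI[OF lim_E]] by (auto simp: Bseq_def)
  have "(\<lambda>n. inverse (q_factorial Q n)) \<longlonglongrightarrow> inverse E"
    using lim_E E0 by (intro tendsto_inverse)
  from convergent_imp_Bseq[OF convergentI[OF this]]
  obtain K' where K': "\<And>n. norm (inverse (q_factorial Q n)) \<le> K'" by (auto simp: Bseq_def)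
  have K0: "K \<ge> 0" "K' \<ge> 0" using K[of 0] K'[of 0] norm_ge_zero by (metis order_trans)+
  define c where "c N n = (if \<bar>n\<bar> \<le> int N
      then q_factorial Q N * q_binomial Q (2 * N) (nat (n + int N)) else 0)" for N n
  have c_le: "norm (c N n) \<le> K * (K * (K' * K'))" for N n
  proof (cases "\<bar>n\<bar> \<le> int N")
    case True
    have "norm (c N n) = norm (q_factorial Q N) * (norm (q_factorial Q (2 * N)) *
        (norm (inverse (q_factorial Q (nat (n + int N)))) *
         norm (inverse (q_factorial Q (2 * N - nat (n + int N))))))"
      using True by (simp add: c_def q_binomial_def norm_mult norm_divide norm_inverse divide_simps)
    also have "\<dots> \<le> K * (K * (K' * K'))"
      using K0 by (intro mult_mono K K') auto
    finally show ?thesis .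
  qed (use K0 in \<open>simp add: c_def\<close>)
  have c_lim: "(\<lambda>N. c N n) \<longlonglongrightarrow> 1" for n
  proof -
    have subseq: "filterlim (\<lambda>N. nat (n + int N)) at_top sequentially" for n
    proof (subst filterlim_at_top, intro allI)
      fix Z
      show "\<forall>\<^sub>F N in sequentially. Z \<le> nat (n + int N)"
        using eventually_ge_at_top[of "nat (int Z - n)"] by eventually_elim auto
    qed
    have "(\<lambda>N. q_factorial Q N * (q_factorial Q (2 * N) /
            (q_factorial Q (nat (n + int N)) * q_factorial Q (nat (- n + int N))))) \<longlonglongrightarrow> E * (E / (E * E))"
      by (intro tendsto_intros lim_E filterlim_compose[OF lim_E] subseq mult_nat_left_at_top)
         (use E0 in auto)
    also have "E * (E / (E * E)) = 1" using E0 by simp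
    finally show ?thesis
    proof (rule Lim_transform_eventually)
      show "\<forall>\<^sub>F N in sequentially. q_factorial Q N * (q_factorial Q (2 * N) /
            (q_factorial Q (nat (n + int N)) * q_factorial Q (nat (- n + int N)))) = c N n"
        using eventually_ge_at_top[of "nat \<bar>n\<bar>"]
      proof eventually_elim
        case (elim N)
        then have "\<bar>n\<bar> \<le> int N" "2 * N - nat (n + int N) = nat (- n + int N)" by auto
        then show ?case by (simp add: c_def q_binomial_def)
      qed
    qed
  qed
  have finite_sum: "(\<Sum>\<^sub>\<infinity>n. c N n * theta_term Q x n)
      = q_factorial Q N * ((\<Prod>k<N. 1 - x * Q ^ k) * (\<Prod>k<N. 1 - Q ^ Suc k / x))" for N
  proof -
    have "(\<Sum>\<^sub>\<infinity>n. c N n * theta_term Q x n) = (\<Sum>\<^sub>\<infinity>n\<in>{-int N..int N}. c N n * theta_term Q x n)"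
      by (rule infsum_cong_neutral) (auto simp: c_def)
    also have "\<dots> = (\<Sum>n\<in>{-int N..int N}. c N n * theta_term Q x n)" by simp
    also have "\<dots> = (\<Sum>k\<le>2 * N. q_factorial Q N * (q_binomial Q (2 * N) k * theta_term Q x (int k - int N)))"
      by (rule sum.reindex_bij_witness[of _ "\<lambda>k. int k - int N" "\<lambda>n. nat (n + int N)"]) (auto simp: c_def)
    finally show ?thesis
      by (simp only: finite_jacobi_triple_product[OF Q1 Q(1) x0] sum_distrib_left)
  qed
  have bound: "norm (c N n * theta_term Q x n) \<le> K * (K * (K' * K')) * r ^ nat \<bar>n\<bar>" for N n
    unfolding norm_mult r_def using K0 c_le norm_theta_term_le[OF Q x] by (intro mult_mono) auto
  have M: "(\<lambda>n::int. K * (K * (K' * K')) * r ^ nat \<bar>n\<bar>) summable_on UNIV"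
    by (intro summable_on_cmult_right summable_on_power_nat_abs_int r)
  have "(\<lambda>N. \<Sum>\<^sub>\<infinity>n. c N n * theta_term Q x n) \<longlonglongrightarrow> (\<Sum>\<^sub>\<infinity>n. theta_term Q x n)"
  proof (rule tannery[OF bound M])
    show "(\<lambda>N. c N n * theta_term Q x n) \<longlonglongrightarrow> theta_term Q x n" for n
      using tendsto_mult[OF c_lim tendsto_const] by simp
  qed
  moreover have "(\<lambda>N. q_factorial Q N * ((\<Prod>k<N. 1 - x * Q ^ k) * (\<Prod>k<N. 1 - Q ^ Suc k / x)))
      \<longlonglongrightarrow> E * (A * B)"
    by (intro tendsto_mult lim_E has_prod_imp_tendsto'[OF A] has_prod_imp_tendsto'[OF B])
  ultimately have "(\<Sum>\<^sub>\<infinity>n. theta_term Q x n) = E * (A * B)"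
    unfolding finite_sum by (rule LIMSEQ_unique)
  moreover have "(\<lambda>n. norm (theta_term Q x n)) summable_on UNIV"
    using norm_theta_term_le[OF Q x] summable_on_power_nat_abs_int[OF r]
    by (intro Infinite_Sum.abs_summable_on_comparison_test') (auto simp: r_def)
  ultimately show ?thesis
    using abs_summable_summable has_sum_infsum by (metis mult.assoc)
qed

section \<open>The theta functions as products over residue classes\<close>

text \<open>
  The exponent \<open>T n\<^sup>2 / 2 + (T - 2 j) n / 2\<close> equals \<open>T (n (n - 1) / 2) + (T - j) n\<close>; in particular
  it is an integer and the branch in \<open>qpow\<close> does not matter.
\<close>
lemma theta_summand_eq_theta_term:
  fixes T j :: nat
  assumes q: "q \<noteq> 0" and j: "j \<le> T"
  shows "(- 1) powi n * qpow q (real T / 2 * (of_int n)\<^sup>2 + (real T - 2 * real j) / 2 * of_int n)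
       = theta_term (q ^ T) (q ^ (T - j)) n"
proof -
  define c where "c = n * (n - 1) div 2"
  have "even (n * (n - 1))" by simp
  then have c: "2 * c = n * (n - 1)" by (simp add: c_def)
  define e where "e = int T * c + int (T - j) * n"
  have "real_of_int (2 * c) = of_int (n * (n - 1))" by (simp only: c)
  then have c': "real_of_int c = of_int n * (of_int n - 1) / 2" by simp
  have e: "real T / 2 * (of_int n)\<^sup>2 + (real T - 2 * real j) / 2 * of_int n = of_int e"
    using j by (simp add: e_def c' of_nat_diff field_simps power2_eq_square)
  have "qpow q (of_int e) = q powi e"
    using q complex_powr_of_int[of q e] by (auto simp: qpow_def)
  also have "\<dots> = (q ^ T) powi c * (q ^ (T - j)) powi n"
    using q by (simp add: e_def power_int_add power_int_mult)
  finally have "(- 1) powi n * qpow q (of_int e) = ((- 1) * q ^ (T - j)) powi n * (q ^ T) powi c"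
    by (simp only: power_int_mult_distrib mult_ac)
  then show ?thesis by (simp only: e theta_term_def c_def mult_minus1)
qed

text \<open>
  The triple product for \<open>Q = q\<^sup>T\<close> and \<open>x = q\<^bsup>T - j\<^esup>\<close>, whose three families of factors run over the
  residue classes of \<open>0\<close>, \<open>T - j\<close> and \<open>j\<close>. The case \<open>q = 0\<close> is separate: there only the term
  \<open>n = 0\<close> survives, because the exponent vanishes only for \<open>n = 0\<close>.
\<close>
theorem theta_eq_exp_log_residue_products:
  assumes j: "1 \<le> j" "j < T" and q: "norm q < 1"
  shows "theta (real T / 2) ((real T - 2 * real j) / 2) q =
     exp (log_residue_product T T q + log_residue_product T j q + log_residue_product T (T - j) q)"
proof (cases "q = 0")
  case True
  have "real T / 2 * (of_int n)\<^sup>2 + (real T - 2 * real j) / 2 * of_int n \<noteq> 0" if "n \<noteq> 0" for n :: int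
  proof
    assume "real T / 2 * (of_int n)\<^sup>2 + (real T - 2 * real j) / 2 * of_int n = 0"
    then have "real_of_int n * (real T * of_int n + (real T - 2 * real j)) = 0"
      by (simp add: field_simps power2_eq_square)
    then have "real T * of_int n + (real T - 2 * real j) = 0"
      using that by (simp only: mult_eq_0_iff of_int_eq_0_iff simp_thms)
    then have "real_of_int (int T * (n + 1)) = of_int (2 * int j)" by (simp add: algebra_simps)
    then have eq: "int T * (n + 1) = 2 * int j" by (simp only: of_int_eq_iff)
    have "int T * (n + 1) > 0" using eq j by simp
    then have "n + 1 > 0" by (simp add: zero_less_mult_iff)
    moreover have "n + 1 < 2"
    proof (rule ccontr)
      assume "\<not> n + 1 < 2"
      then have "int T * 2 \<le> int T * (n + 1)" by (intro mult_left_mono) auto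
      then show False using eq j by simp
    qed
    ultimately show False using that by simp
  qed
  then have "theta (real T / 2) ((real T - 2 * real j) / 2) q = (\<Sum>\<^sub>\<infinity>n::int\<in>{0}. 1)"
    unfolding theta_def True by (intro infsum_cong_neutral) (auto simp: qpow_def)
  then show ?thesis by (simp add: True)
next
  case False
  define Q where "Q = q ^ T"
  define x where "x = q ^ (T - j)"
  have r: "0 < norm q" "norm q < 1" using False q by auto
  have x1: "norm x < 1" using r j by (simp add: x_def norm_power power_less_one_iff)
  have Qx: "norm Q < norm x"
    using r j by (simp add: Q_def x_def norm_power power_strict_decreasing)
  have Q0: "Q \<noteq> 0" using False by (simp add: Q_def)
  have Qdiv: "Q ^ Suc n / x = q ^ (n * T + j)" for n
  proof -
    have "n * T + T = (n * T + j) + (T - j)" using j by simp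
    then have "q ^ (n * T + T) = q ^ (n * T + j) * x" by (simp only: power_add x_def)
    moreover have "Q ^ Suc n = q ^ (n * T + T)"
      by (simp add: Q_def power_add mult.commute flip: power_mult)
    ultimately show ?thesis using False by (simp add: x_def)
  qed
  have E: "(\<lambda>n. 1 - Q ^ Suc n) has_prod exp (log_residue_product T T q)"
    using residue_product_has_prod[of T T q] j q
    by (simp add: Q_def power_add mult.commute flip: power_mult)
  have A: "(\<lambda>n. 1 - x * Q ^ n) has_prod exp (log_residue_product T (T - j) q)"
  proof -
    have "x * Q ^ n = q ^ (n * T + (T - j))" for n
      by (simp only: Q_def x_def power_add power_mult[symmetric] mult.commute)
    then show ?thesis using residue_product_has_prod[of "T - j" T q] j q by simp
  qed
  have B: "(\<lambda>n. 1 - Q ^ Suc n / x) has_prod exp (log_residue_product T j q)"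
    unfolding Qdiv using residue_product_has_prod[of j T q] j q by simp
  have "theta (real T / 2) ((real T - 2 * real j) / 2) q = (\<Sum>\<^sub>\<infinity>n. theta_term Q x n)"
    unfolding theta_def Q_def x_def using False j
    by (intro infsum_cong theta_summand_eq_theta_term) auto
  also have "\<dots> = exp (log_residue_product T T q) * exp (log_residue_product T (T - j) q) * exp (log_residue_product T j q)"
    using jacobi_triple_product[OF Q0 Qx x1 E A B] by (rule infsumI)
  finally show ?thesis by (simp add: exp_add mult_ac)
qed

section \<open>Branches of logarithms and powers\<close>

text \<open>
  The difference of two logarithms of the same function is a continuous function with values in the
  discrete set of multiples of \<open>2 \<pi> \<i>\<close>, hence constant on the disc, and it vanishes at 0.
\<close>
lemma disc_log_eq:
  assumes h: "h holomorphic_on ball 0 1" "h 0 = 0" "\<And>z. z \<in> ball 0 1 \<Longrightarrow> exp (h z) = g z"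
    and z: "z \<in> ball 0 1"
  shows "disc_log g z = h z"
proof -
  define k where "k = disc_log g"
  have k: "k holomorphic_on ball 0 1" "k 0 = 0" "\<And>z. z \<in> ball 0 1 \<Longrightarrow> exp (k z) = g z"
    using someI[of "\<lambda>h. h holomorphic_on ball 0 1 \<and> h 0 = 0 \<and> (\<forall>z\<in>ball 0 1. exp (h z) = g z)" h] h
    unfolding k_def disc_log_def by blast+
  have "(\<lambda>z. k z - h z) constant_on ball 0 1"
  proof (rule continuous_discrete_range_constant)
    show "continuous_on (ball 0 1) (\<lambda>z. k z - h z)"
      using h k by (intro continuous_intros holomorphic_on_imp_continuous_on)
    fix w :: complex assume w: "w \<in> ball 0 1"
    show "\<exists>e>0. \<forall>y. y \<in> ball 0 1 \<and> k y - h y \<noteq> k w - h w \<longrightarrow> e \<le> norm ((k y - h y) - (k w - h w))"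
    proof (intro exI conjI allI impI)
      fix y assume y: "y \<in> ball 0 1 \<and> k y - h y \<noteq> k w - h w"
      have e1: "exp (k v - h v) = 1" if "v \<in> ball 0 1" for v
      proof -
        have "exp (k v) = exp (h v)" using h(3)[OF that] k(3)[OF that] by simp
        then show ?thesis by (simp add: exp_diff)
      qed
      define u where "u = (k y - h y) - (k w - h w)"
      from e1 have "exp ((k y - h y) - (k w - h w)) = 1"
        using y w e1[of y] e1[of w] by (simp add: exp_diff[of "k y - h y"])
      then have "exp u = 1" by (simp only: u_def)
      then obtain n :: int where Re: "Re u = 0" and Im: "Im u = of_int (2 * n) * pi"
        by (auto simp only: exp_eq_1)
      have "u \<noteq> 0" using y by (simp add: u_def)
      then have "n \<noteq> 0" using Re Im by (auto simp: complex_eq_iff)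
      then have n: "\<bar>of_int n :: real\<bar> \<ge> 1" by linarith
      have "norm u = \<bar>of_int n\<bar> * (2 * pi)" using Re by (simp add: cmod_def Im abs_mult)
      then have "2 * pi \<le> norm u" using mult_right_mono[OF n, of "2 * pi"] by simp
      then show "2 * pi \<le> norm ((k y - h y) - (k w - h w))" by (simp only: u_def)
    qed simp
  qed auto
  then have "k z - h z = k 0 - h 0"
    using z unfolding constant_on_def by (metis centre_in_ball zero_less_one)
  then show ?thesis using h k by (simp add: k_def)
qed

lemma exp_powr_real:
  fixes z :: complex
  assumes "z \<in> \<real>"
  shows "exp z powr s = exp (s * z)"
proof -
  have "Im z = 0" using assms by (simp add: complex_is_Real_iff)
  then have "Ln (exp z) = z" by (intro Ln_exp) auto
  then show ?thesis by (simp add: powr_def)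
qed

section \<open>Closure properties of algebraic numbers\<close>

interpretation rat_space: vector_space "\<lambda>(r :: rat) (x :: 'a :: field_char_0). of_rat r * x"
  by standard (auto simp: algebra_simps of_rat_add of_rat_mult)

text \<open>Multiplication is bilinear over the rationals, so it suffices to multiply the generators.\<close>
lemma span_mult_closed:
  assumes u: "u \<in> rat_space.span A" and v: "v \<in> rat_space.span B"
  shows "u * v \<in> rat_space.span ((\<lambda>(a, b). a * b) ` (A \<times> B))"
    (is "_ \<in> rat_space.span ?AB")
proof -
  have gen: "a * v \<in> rat_space.span ?AB" if a: "a \<in> A" for a
    using v
  proof (induction rule: rat_space.span_induct_alt)
    case base
    show ?case by (simp add: rat_space.span_zero)
  next
    case (step c b y)
    have "a * b \<in> rat_space.span ?AB"
      using a step by (intro rat_space.span_base) auto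
    then have "of_rat c * (a * b) + a * y \<in> rat_space.span ?AB"
      using step by (intro rat_space.span_add rat_space.span_scale)
    then show ?case by (simp add: algebra_simps)
  qed
  show ?thesis
    using u
  proof (induction rule: rat_space.span_induct_alt)
    case base
    show ?case by (simp add: rat_space.span_zero)
  next
    case (step c a y)
    have "of_rat c * (a * v) + y * v \<in> rat_space.span ?AB"
      using step gen
      by (intro rat_space.span_add rat_space.span_scale) auto
    then show ?case by (simp add: algebra_simps)
  qed
qed

text \<open>
  An algebraic equation of degree \<open>m\<close> expresses \<open>x\<^sup>m\<close>, and by induction every higher power, through the
  powers below \<open>m\<close>.
\<close>
lemma algebraic_powers_in_finite_span:
  assumes "algebraic x"
  obtains m where "\<And>k. x ^ k \<in> rat_space.span ((\<lambda>i. x ^ i) ` {..<m :: nat})"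
proof -
  from assms obtain p where p: "\<And>i. coeff p i \<in> \<rat>" "p \<noteq> 0" "poly p x = 0"
    unfolding algebraic_altdef by blast
  define m where "m = degree p"
  have lc: "coeff p m \<noteq> 0" using p by (simp add: m_def)
  have "\<exists>c. - coeff p i / coeff p m = of_rat c" for i
    using p(1) by (meson Rats_cases Rats_divide Rats_minus_iff)
  then obtain c where c: "\<And>i. - coeff p i / coeff p m = of_rat (c i)" by metis
  have "(\<Sum>i<m. coeff p i * x ^ i) + coeff p m * x ^ m = 0"
    using p(3) by (simp add: poly_altdef m_def flip: lessThan_Suc_atMost)
  then have "x ^ m = - (\<Sum>i<m. coeff p i * x ^ i) / coeff p m"
    using lc by (simp add: field_simps eq_neg_iff_add_eq_0)
  also have "\<dots> = (\<Sum>i<m. of_rat (c i) * x ^ i)"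
    unfolding c[symmetric] by (simp add: sum_divide_distrib sum_negf)
  finally have top: "x ^ m = (\<Sum>i<m. of_rat (c i) * x ^ i)" .
  have "x ^ k \<in> rat_space.span ((\<lambda>i. x ^ i) ` {..<m})" for k
  proof (induction k rule: less_induct)
    case (less k)
    show ?case
    proof (cases "k < m")
      case True
      then show ?thesis by (intro rat_space.span_base) auto
    next
      case False
      then have "x ^ k = x ^ (k - m) * x ^ m" by (simp flip: power_add)
      also have "\<dots> = (\<Sum>i<m. of_rat (c i) * x ^ (k - m + i))"
        by (simp add: top sum_distrib_left power_add mult_ac)
      also have "\<dots> \<in> rat_space.span ((\<lambda>i. x ^ i) ` {..<m})"
        using False by (intro rat_space.span_sum rat_space.span_scale less.IH) auto
      finally show ?thesis .
    qed
  qed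
  then show ?thesis by (rule that)
qed

text \<open>
  Among the first \<open>card F + 1\<close> powers of \<open>z\<close> either two coincide or there is a rational linear relation;
  in both cases \<open>z\<close> is a root of a non-zero rational polynomial.
\<close>
lemma algebraic_if_powers_in_finite_span:
  fixes z :: "'a :: field_char_0"
  assumes "finite F" and span: "\<And>k. z ^ k \<in> rat_space.span F"
  shows "algebraic z"
proof (cases "inj_on (\<lambda>k. z ^ k) {..card F}")
  case False
  then obtain i j where ij: "i \<noteq> j" "z ^ i = z ^ j" by (auto simp: inj_on_def)
  show ?thesis
  proof (rule algebraicI)
    show "coeff (monom 1 i - monom 1 j :: 'a poly) n \<in> \<int>" for n by auto
    have "coeff (monom 1 i - monom 1 j :: 'a poly) i \<noteq> 0" using ij by simp
    then show "monom 1 i - monom 1 j \<noteq> (0 :: 'a poly)" by (metis coeff_0)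
    show "poly (monom 1 i - monom 1 j) z = 0" using ij by (simp add: poly_monom)
  qed
next
  case True
  let ?S = "(\<lambda>k. z ^ k) ` {..card F}"
  have "card ?S = Suc (card F)" using True by (simp add: card_image)
  moreover have "?S \<subseteq> rat_space.span F" using span by auto
  ultimately have "rat_space.dependent ?S"
    using rat_space.independent_span_bound[OF \<open>finite F\<close>, of ?S] by auto
  then obtain t u v where t: "finite t" "t \<subseteq> ?S" "(\<Sum>v\<in>t. of_rat (u v) * v) = 0" "v \<in> t" "u v \<noteq> 0"
    unfolding rat_space.dependent_explicit by blast
  \<comment> \<open>the relation lives on the set of powers; injectivity lets it be indexed by the exponents\<close>
  define a where "a k = (if z ^ k \<in> t then u (z ^ k) else 0)" for k
  define p :: "'a poly" where "p = (\<Sum>k\<le>card F. monom (of_rat (a k)) k)"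
  have coeff_p: "coeff p n = (if n \<le> card F then of_rat (a n) else 0)" for n
    by (simp add: p_def coeff_sum)
  show ?thesis
  proof (rule algebraicI')
    show "coeff p n \<in> \<rat>" for n by (simp add: coeff_p)
    obtain k where k: "k \<le> card F" "v = z ^ k" using t by auto
    then have "coeff p k \<noteq> 0" using t by (simp add: coeff_p a_def)
    then show "p \<noteq> 0" by auto
    have "poly p z = (\<Sum>k\<le>card F. of_rat (a k) * z ^ k)"
      by (simp add: p_def poly_sum poly_monom)
    also have "\<dots> = (\<Sum>v\<in>?S. (if v \<in> t then of_rat (u v) * v else 0))"
      using True by (subst sum.reindex) (auto simp: a_def intro!: sum.cong)
    also have "\<dots> = (\<Sum>v\<in>t. of_rat (u v) * v)"
      using t by (intro sum.mono_neutral_cong_right) auto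
    finally show "poly p z = 0" using t by simp
  qed
qed

theorem algebraic_mult:
  assumes "algebraic x" "algebraic y"
  shows "algebraic (x * y)"
proof -
  obtain m where m: "\<And>k. x ^ k \<in> rat_space.span ((\<lambda>i. x ^ i) ` {..<m :: nat})"
    using algebraic_powers_in_finite_span[OF assms(1)] by blast
  obtain n where n: "\<And>k. y ^ k \<in> rat_space.span ((\<lambda>i. y ^ i) ` {..<n :: nat})"
    using algebraic_powers_in_finite_span[OF assms(2)] by blast
  show ?thesis
  proof (rule algebraic_if_powers_in_finite_span)
    show "(x * y) ^ k \<in> rat_space.span ((\<lambda>(a, b). a * b) ` (((\<lambda>i. x ^ i) ` {..<m}) \<times> ((\<lambda>i. y ^ i) ` {..<n})))" for k
      unfolding power_mult_distrib by (rule span_mult_closed[OF m n])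
  qed auto
qed

lemma algebraic_power: "algebraic x \<Longrightarrow> algebraic (x ^ n)"
  by (induction n) (auto intro: algebraic_mult)

lemma algebraic_prod: "(\<And>i. i \<in> A \<Longrightarrow> algebraic (f i)) \<Longrightarrow> algebraic (prod f A)"
  by (induction A rule: infinite_finite_induct) (auto intro: algebraic_mult)

lemma algebraic_powr_rat:
  fixes x :: real
  assumes "algebraic x" "x > 0" "s \<in> \<rat>"
  shows "algebraic (x powr s)"
proof -
  obtain a :: int and b :: nat where ab: "b > 0" "s = of_int a / of_nat b"
    using assms(3) by (elim Rats_cases') (metis of_int_of_nat_eq pos_int_cases zero_less_imp_eq_int)
  have "(x powr s) ^ b = x powr of_int a"
    using ab assms by (simp add: powr_powr flip: powr_realpow)
  also have "\<dots> = x powi a" using assms by (simp add: powr_real_of_int')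
  finally have "x powr s = root b (x powi a)"
    using ab assms by (metis powr_ge_zero real_root_pos2)
  moreover have "algebraic (x powi a)"
    unfolding power_int_def using assms by (auto intro: algebraic_power algebraic_inverse)
  ultimately show ?thesis by auto
qed

section \<open>The product formula\<close>

text \<open>
  The infinite product of the assumption (C) for \<open>p = T\<close> and \<open>a = j\<close> runs over the classes of \<open>j\<close> and
  \<open>T - j\<close>, so it is the exponential of the sum of their logarithms.
\<close>
lemma residue_pair_prodinf_real:
  fixes q l :: real
  assumes q: "0 < q" "q < 1" and j: "1 \<le> j" "j < T"
    and l: "log_residue_product T j (of_real q) + log_residue_product T (T - j) (of_real q) = of_real l"
  shows "(\<Prod>n. (1 - q powr (real T * real n + real j)) * (1 - q powr (real T * real n + real T - real j))) = exp l"
proof -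
  have "(\<lambda>n. (1 - of_real q ^ (n * T + j)) * (1 - of_real q ^ (n * T + (T - j)))) has_prod
      (exp (log_residue_product T j (of_real q)) * exp (log_residue_product T (T - j) (of_real q)))"
    using q j by (intro has_prod_mult residue_product_has_prod) auto
  also have "exp (log_residue_product T j (of_real q)) * exp (log_residue_product T (T - j) (of_real q)) = complex_of_real (exp l)"
    by (simp only: exp_add[symmetric] l exp_of_real)
  also have "(\<lambda>n. (1 - of_real q ^ (n * T + j)) * (1 - of_real q ^ (n * T + (T - j)))) =
      (\<lambda>n. complex_of_real ((1 - q powr (real T * real n + real j)) * (1 - q powr (real T * real n + real T - real j))))"
  proof
    fix n
    have "q powr (real T * real n + real j) = q ^ (n * T + j)"
      using q by (simp add: mult.commute flip: powr_realpow)
    moreover have "q powr (real T * real n + real T - real j) = q ^ (n * T + (T - j))"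
      using q j by (simp add: mult.commute of_nat_diff add_diff_eq flip: powr_realpow)
    ultimately show "(1 - of_real q ^ (n * T + j)) * (1 - of_real q ^ (n * T + (T - j))) =
      complex_of_real ((1 - q powr (real T * real n + real j)) * (1 - q powr (real T * real n + real T - real j)))"
      by simp
  qed
  finally have "(\<lambda>n. (1 - q powr (real T * real n + real j)) * (1 - q powr (real T * real n + real T - real j))) has_prod exp l"
    unfolding has_prod_of_real_iff .
  then show ?thesis by (simp only: has_prod_iff)
qed

text \<open>
  For \<open>f\<close> analytic on the real segment only, the identity theorem is applied to the connected component
  of 0 in an open set on which \<open>f\<close> is holomorphic, intersected with the disc; it contains the segment.
\<close>
theorem theorem1:
  fixes f :: "complex \<Rightarrow> complex" and X :: "nat \<Rightarrow> complex" and T :: nat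
  assumes analytic: "f analytic_on (complex_of_real ` {-1<..<1})"
    and f0: "f 0 = 0"
    and X_def: "X = mobius_coeff f"
    and T_pos: "0 < T"
    and symmetric: "catoptric T X"
    and even_case: "even T \<Longrightarrow> X (T div 2) = 0"
    and real_valued: "\<forall>n\<ge>1. X n \<in> \<real>"
  shows
    "(\<forall>q::real. \<bar>q\<bar> < 1 \<longrightarrow>
        exp (- f (of_real q)) =
          eta_q (of_real q ^ T) powr (- (\<Sum>j = 1..(T - 1) div 2. X j)) *
          (\<Prod>j = 1..(T - 1) div 2.
             theta (real T / 2) ((real T - 2 * real j) / 2) (of_real q) powr X j))
     \<and>
     (f analytic_on ball 0 1 \<longrightarrow>
       (\<forall>q::complex. norm q < 1 \<longrightarrow>
          exp (- f q) =
            disc_powr (\<lambda>z. eta_q (z ^ T)) (- (\<Sum>j = 1..(T - 1) div 2. X j)) q *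
            (\<Prod>j = 1..(T - 1) div 2.
               disc_powr (theta (real T / 2) ((real T - 2 * real j) / 2)) (X j) q)))
     \<and>
     ((\<forall>a\<in>\<rat>. \<forall>p\<in>\<rat>. \<forall>r\<in>\<rat>. 0 < a \<and> a < p \<and> 0 < r \<longrightarrow>
         (let q = exp (- pi * sqrt r) :: real in
           algebraic
             (q powr (p / 12 - a / 2 + a\<^sup>2 / (2 * p)) *
              (\<Prod>n. (1 - q powr (p * real n + a)) * (1 - q powr (p * real n + p - a))))))
      \<longrightarrow> (\<forall>j\<in>{1..(T - 1) div 2}. X j \<in> \<rat>)
      \<longrightarrow> (\<forall>r\<in>\<rat>. 0 < r \<longrightarrow>
            (let q = exp (- pi * sqrt r) :: real;
                 A = (\<Sum>j = 1..(T - 1) div 2.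
                        of_real (- real j / 2 + (real j)\<^sup>2 / (2 * real T) + real T / 12) * X j)
             in algebraic (of_real q powr A * exp (- f (of_real q))))))"
proof -
  let ?S = "{1..(T - 1) div 2}"
  let ?L = "log_residue_product T"
  have S: "1 \<le> j" "j < T" if "j \<in> ?S" for j
    using that T_pos by auto
  have even: "even T \<longrightarrow> X (T div 2) = 0" using even_case by blast
  obtain B where B: "\<And>d. d \<ge> 1 \<Longrightarrow> norm (X d) \<le> B"
    using catoptric_bounded[OF T_pos symmetric even] by blast
  have f_on: "- f z = (\<Sum>j\<in>?S. X j * (?L j z + ?L (T - j) z))"
    if U: "f holomorphic_on U" "open U" "connected U" "0 \<in> U" "U \<subseteq> ball 0 1" "z \<in> U" for U z
  proof -
    have "f z = - log_product X z"
      unfolding X_def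
      by (rule eq_neg_log_product_mobius_coeff[OF U(1-5) f0 B[unfolded X_def] U(6)])
    moreover have "norm z < 1" using U by auto
    ultimately show ?thesis
      using log_product_catoptric[OF T_pos symmetric even, of z] by simp
  qed
  have f_real: "- f (of_real q) = (\<Sum>j\<in>?S. X j * (?L j (of_real q) + ?L (T - j) (of_real q)))"
    if q: "\<bar>q :: real\<bar> < 1" for q
  proof -
    let ?I = "complex_of_real ` {-1<..<1}"
    obtain V where V: "open V" "?I \<subseteq> V" "f holomorphic_on V"
      using analytic unfolding analytic_on_holomorphic by blast
    define U where "U = connected_component_set (V \<inter> ball 0 1) 0"
    have "connected ?I"
      by (intro connected_continuous_image continuous_intros) auto
    moreover have "0 \<in> ?I" by (auto intro!: image_eqI[of _ _ 0])
    moreover have "?I \<subseteq> V \<inter> ball 0 1" using V by auto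
    ultimately have I: "?I \<subseteq> U" unfolding U_def by (intro connected_component_maximal)
    have sub: "U \<subseteq> V \<inter> ball 0 1" unfolding U_def by (rule connected_component_subset)
    show ?thesis
    proof (rule f_on)
      show "f holomorphic_on U" using V(3) sub by (auto elim: holomorphic_on_subset)
      show "open U" unfolding U_def using V by (intro open_connected_component) auto
      show "connected U" unfolding U_def by (rule connected_connected_component)
      show "0 \<in> U" using I \<open>0 \<in> ?I\<close> by blast
      show "U \<subseteq> ball 0 1" using sub by blast
      show "of_real q \<in> U" using q by (intro subsetD[OF I] imageI) auto
    qed
  qed
  \<comment> \<open>in every theta function the factor \<open>E\<close> of the class of 0 cancels against the eta product\<close>
  have collect: "exp (- (\<Sum>j\<in>?S. X j) * E) * (\<Prod>j\<in>?S. exp (X j * (E + a j + b j)))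
      = exp (\<Sum>j\<in>?S. X j * (a j + b j))" for E :: complex and a b
  proof -
    have "exp (- (\<Sum>j\<in>?S. X j) * E) * (\<Prod>j\<in>?S. exp (X j * (E + a j + b j)))
        = exp (- (\<Sum>j\<in>?S. X j) * E + (\<Sum>j\<in>?S. X j * (E + a j + b j)))"
      by (simp only: exp_add exp_sum finite_atLeastAtMost)
    also have "- (\<Sum>j\<in>?S. X j) * E + (\<Sum>j\<in>?S. X j * (E + a j + b j)) = (\<Sum>j\<in>?S. X j * (a j + b j))"
      by (simp add: sum_distrib_right sum.distrib ring_distribs)
    finally show ?thesis .
  qed
  show ?thesis
  proof (intro conjI allI impI ballI)
    fix q :: real assume q: "\<bar>q\<bar> < 1"
    have eta: "eta_q (of_real q ^ T) powr s = exp (s * ?L T (of_real q))" for s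
      using q T_pos by (simp add: eta_q_power exp_powr_real log_residue_product_real)
    have theta: "theta (real T / 2) ((real T - 2 * real j) / 2) (of_real q) powr X j
        = exp (X j * (?L T (of_real q) + ?L j (of_real q) + ?L (T - j) (of_real q)))" if "j \<in> ?S" for j
      using q S[OF that]
      by (simp add: theta_eq_exp_log_residue_products exp_powr_real log_residue_product_real)
    show "exp (- f (of_real q)) =
          eta_q (of_real q ^ T) powr (- (\<Sum>j\<in>?S. X j)) *
          (\<Prod>j\<in>?S. theta (real T / 2) ((real T - 2 * real j) / 2) (of_real q) powr X j)"
      unfolding f_real[OF q] eta using theta by (simp only: collect cong: prod.cong)
  next
    fix q :: complex assume f: "f analytic_on ball 0 1" and q: "norm q < 1"
    have eta: "disc_powr (\<lambda>z. eta_q (z ^ T)) s q = exp (s * ?L T q)" for s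
    proof -
      have "disc_log (\<lambda>z. eta_q (z ^ T)) q = ?L T q"
        using q T_pos
        by (intro disc_log_eq log_residue_product_holomorphic log_product_0) (auto simp: eta_q_power)
      then show ?thesis by (simp add: disc_powr_def)
    qed
    have theta: "disc_powr (theta (real T / 2) ((real T - 2 * real j) / 2)) (X j) q
        = exp (X j * (?L T q + ?L j q + ?L (T - j) q))" if "j \<in> ?S" for j
    proof -
      have "disc_log (theta (real T / 2) ((real T - 2 * real j) / 2)) q = ?L T q + ?L j q + ?L (T - j) q"
        using q S[OF that]
        by (intro disc_log_eq[where h = "\<lambda>z. ?L T z + ?L j z + ?L (T - j) z"]
              holomorphic_intros log_residue_product_holomorphic)
           (auto simp: theta_eq_exp_log_residue_products)
      then show ?thesis by (simp add: disc_powr_def)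
    qed
    have "- f q = (\<Sum>j\<in>?S. X j * (?L j q + ?L (T - j) q))"
      using f q by (intro f_on[of "ball 0 1"]) (auto intro: analytic_imp_holomorphic)
    then show "exp (- f q) =
            disc_powr (\<lambda>z. eta_q (z ^ T)) (- (\<Sum>j\<in>?S. X j)) q *
            (\<Prod>j\<in>?S. disc_powr (theta (real T / 2) ((real T - 2 * real j) / 2)) (X j) q)"
      unfolding eta using theta by (simp only: collect cong: prod.cong)
  next
    fix r :: real
    assume C: "\<forall>a\<in>\<rat>. \<forall>p\<in>\<rat>. \<forall>r\<in>\<rat>. 0 < a \<and> a < p \<and> 0 < r \<longrightarrow>
         (let q = exp (- pi * sqrt r) :: real in
           algebraic
             (q powr (p / 12 - a / 2 + a\<^sup>2 / (2 * p)) *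
              (\<Prod>n. (1 - q powr (p * real n + a)) * (1 - q powr (p * real n + p - a)))))"
      and X_rat: "\<forall>j\<in>?S. X j \<in> \<rat>" and r: "r \<in> \<rat>" "0 < r"
    define q where "q = exp (- pi * sqrt r)"
    have q: "0 < q" "q < 1" using r by (auto simp: q_def)
    define l where "l j = Re (?L j (of_real q) + ?L (T - j) (of_real q))" for j
    have l: "?L j (of_real q) + ?L (T - j) (of_real q) = of_real (l j)" for j
      unfolding l_def using q by (intro of_real_Re[symmetric] Reals_add log_residue_product_real) auto
    define x where "x j = Re (X j)" for j
    have x: "X j = of_real (x j)" "x j \<in> \<rat>" if "j \<in> ?S" for j
    proof -
      have "X j \<in> \<rat>" using X_rat that by blast
      then obtain c where "X j = of_rat c" by (rule Rats_cases)
      moreover have "of_rat c = complex_of_real (of_rat c)" by (cases c) (simp add: of_rat_rat)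
      ultimately have "X j = of_real (of_rat c)" by simp
      then show "X j = of_real (x j)" "x j \<in> \<rat>" by (simp_all add: x_def)
    qed
    define \<alpha> where "\<alpha> j = - real j / 2 + (real j)\<^sup>2 / (2 * real T) + real T / 12" for j
    define A where "A = (\<Sum>j\<in>?S. of_real (\<alpha> j) * X j)"
    have factor: "algebraic ((q powr \<alpha> j * exp (l j)) powr x j)" if j: "j \<in> ?S" for j
    proof (rule algebraic_powr_rat)
      have "algebraic (q powr (real T / 12 - real j / 2 + (real j)\<^sup>2 / (2 * real T)) *
          (\<Prod>n. (1 - q powr (real T * real n + real j)) * (1 - q powr (real T * real n + real T - real j))))"
        using C[rule_format, of "real j" "real T" r] S[OF j] r by (simp add: Let_def q_def)
      moreover have "\<alpha> j = real T / 12 - real j / 2 + (real j)\<^sup>2 / (2 * real T)" by (simp add: \<alpha>_def)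
      ultimately show "algebraic (q powr \<alpha> j * exp (l j))"
        by (simp only: residue_pair_prodinf_real[OF q S[OF j] l])
    qed (use q x j in auto)
    have "(q powr \<alpha> j * exp (l j)) powr x j = q powr (\<alpha> j * x j) * exp (x j * l j)" for j
      using q by (simp add: powr_def ln_mult algebra_simps flip: exp_add)
    then have "algebraic (\<Prod>j\<in>?S. q powr (\<alpha> j * x j) * exp (x j * l j))"
      using factor by (intro algebraic_prod) simp
    also have "(\<Prod>j\<in>?S. q powr (\<alpha> j * x j) * exp (x j * l j))
        = q powr (\<Sum>j\<in>?S. \<alpha> j * x j) * exp (\<Sum>j\<in>?S. x j * l j)"
      using q by (simp add: prod.distrib powr_sum exp_sum)
    finally have "algebraic (complex_of_real (q powr (\<Sum>j\<in>?S. \<alpha> j * x j) * exp (\<Sum>j\<in>?S. x j * l j)))"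
      by (rule algebraic_of_real)
    also have "complex_of_real (q powr (\<Sum>j\<in>?S. \<alpha> j * x j) * exp (\<Sum>j\<in>?S. x j * l j))
        = of_real q powr A * exp (- f (of_real q))"
    proof -
      have "A = of_real (\<Sum>j\<in>?S. \<alpha> j * x j)" using x by (simp add: A_def)
      moreover have "- f (of_real q) = of_real (\<Sum>j\<in>?S. x j * l j)"
        using f_real[of q] q x l by simp
      ultimately show ?thesis
        using q by (simp only: of_real_mult powr_of_real[OF less_imp_le] exp_of_real)
    qed
    finally show "let q = exp (- pi * sqrt r) :: real;
                 A = (\<Sum>j\<in>?S. of_real (- real j / 2 + (real j)\<^sup>2 / (2 * real T) + real T / 12) * X j)
             in algebraic (of_real q powr A * exp (- f (of_real q)))"
      by (simp add: Let_def q_def A_def \<alpha>_def)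
  qed
qed

end
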